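(* Let $n\ge1$ and let $A$ and $B$ be $n$-isoclinic symmetric skew braces. Then the group $(A,\cdot)$ is $n$-isoclinic to the group $(B,\cdot)$, and the group $(A,\circ)$ is $n$-isoclinic to the group $(B,\circ)$.
   Context: A skew (left) brace is a set $A$ with two group structures $(A,\cdot)$, $(A,\circ)$ such that $a\circ(b\cdot c)=(a\circ b)\cdot a^{-1}\cdot(a\circ c)$ for all $a,b,c$, where $a^{-1}$ is the inverse in $(A,\cdot)$. The two identities coincide, denoted $1$. It is symmetric if $(A,\circ,\cdot)$ is also a skew brace. Put $\lambda_a(b)=a^{-1}\cdot(a\circ b)$, $a*b=\lambda_a(b)\cdot b^{-1}$, $[a,b]^{\cdot}=a\cdot b\cdot a^{-1}\cdot b^{-1}$. Brace homomorphisms preserve both operations. Annihilator series: $\mathrm{Ann}_0(A)=1$, $\mathrm{Ann}(A)=\mathrm{Ann}_1(A)=\{a: a*b=b*a=[a,b]^{\cdot}=1\ \forall b\in A\}$, $\mathrm{Ann}_n(A)/\mathrm{Ann}_{n-1}(A)=\mathrm{Ann}(A/\mathrm{Ann}_{n-1}(A))$; these are ideals of $A$ (subgroups of $(A,\cdot)$ stable under all $\lambda_a$ and normal in both groups). Commutator words: $M$ is the free monoid on the four symbols $X=\{\gamma,\bar\gamma,*,\bar *\}$, where $\gamma(a,b)=[a,b]^{\cdot}$, $\bar\gamma(a,b)=[b,a]^{\cdot}$, $*(a,b)=a*b$, $\bar *(a,b)=b*a$. For $m=\epsilon_1\cdots\epsilon_s\in M$ ($\epsilon_i\in X$), $\deg(m)=s$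 and $m(a_1a_2\cdots a_{s+1})=\epsilon_1(a_1,\epsilon_2(a_2,\ldots,\epsilon_s(a_s,a_{s+1})\cdots))$. $A_{(t)}$ is the subgroup of $(A,\cdot)$ generated by all values $m(a_1\cdots a_{\deg(m)+1})$ with $m\in M$, $\deg(m)\ge t$, $a_i\in A$ (it is a sub-skew brace). For a symmetric skew brace $A$ and every $m\in M$ with $\deg(m)=n$ the map $\phi^A_m:(A/\mathrm{Ann}_n(A))^{n+1}\to A_{(n)}$, $(\mathrm{Ann}_n(A)a_1,\ldots,\mathrm{Ann}_n(A)a_{n+1})\mapsto m(a_1\cdots a_{n+1})$, is well defined. Symmetric skew braces $A,B$ are $n$-isoclinic if there are brace isomorphisms $\xi:A/\mathrm{Ann}_n(A)\to B/\mathrm{Ann}_n(B)$ and $\theta:A_{(n)}\to B_{(n)}$ with $\theta\circ\phi^A_m=\phi^B_m\circ\xi^{n+1}$ for all $m\in M$ with $\deg(m)=n$, where $\xi^{n+1}=\xi\times\cdots\times\xi$ ($n+1$ copies). Groups $G,H$ are $n$-isoclinic if there are group isomorphisms $\alpha:G/\mathrm{Z}_n(G)\to H/\mathrm{Z}_n(H)$ and $\beta:\gamma_{n+1}(G)\to\gamma_{n+1}(H)$ (upper and lower central series terms) such that $\beta([g_1,[g_2,\ldots,[g_n,g_{n+1}]\ldots]])=[h_1,[h_2,\ldots,[h_n,h_{n+1}]\ldots]]$ whenever $\alpha(\mathrm{Z}_n(G)g_i)=\mathrm{Z}_n(H)h_i$ for $1\le i\le n+1$. *)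

theory Defs
  imports "HOL-Algebra.Algebra"
begin

section \<open>Group commutators, central series and isoclinism of groups\<close>

definition commutator :: "('a, 'm) monoid_scheme \<Rightarrow> 'a \<Rightarrow> 'a \<Rightarrow> 'a" where
  "commutator G a b = a \<otimes>\<^bsub>G\<^esub> b \<otimes>\<^bsub>G\<^esub> inv\<^bsub>G\<^esub> a \<otimes>\<^bsub>G\<^esub> inv\<^bsub>G\<^esub> b"

definition group_center :: "('a, 'm) monoid_scheme \<Rightarrow> 'a set" where
  "group_center G = {z \<in> carrier G. \<forall>g \<in> carrier G. z \<otimes>\<^bsub>G\<^esub> g = g \<otimes>\<^bsub>G\<^esub> z}"

primrec upper_central :: "('a, 'm) monoid_scheme \<Rightarrow> nat \<Rightarrow> 'a set" where
  "upper_central G 0 = {\<one>\<^bsub>G\<^esub>}"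
| "upper_central G (Suc n) =
     {g \<in> carrier G. upper_central G n #>\<^bsub>G\<^esub> g \<in> group_center (G Mod upper_central G n)}"

text \<open>The usual numbering starts at 1; the value at 0 is a dummy.\<close>

fun lower_central :: "('a, 'm) monoid_scheme \<Rightarrow> nat \<Rightarrow> 'a set" where
  "lower_central G 0 = carrier G"
| "lower_central G (Suc 0) = carrier G"
| "lower_central G (Suc (Suc n)) =
     generate G {commutator G g x | g x. g \<in> carrier G \<and> x \<in> lower_central G (Suc n)}"

text \<open>The right-normed commutator $[g_1,[g_2,\ldots,[g_n,g_{n+1}]\ldots]]$ of a nonempty list.\<close>

fun iterated_commutator :: "('a, 'm) monoid_scheme \<Rightarrow> 'a list \<Rightarrow> 'a" where
  "iterated_commutator G [] = \<one>\<^bsub>G\<^esub>"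
| "iterated_commutator G [g] = g"
| "iterated_commutator G (g # h # gs) = commutator G g (iterated_commutator G (h # gs))"

definition group_isoclinic ::
  "nat \<Rightarrow> ('a, 'm) monoid_scheme \<Rightarrow> ('b, 'k) monoid_scheme \<Rightarrow> bool" where
  "group_isoclinic n G H \<longleftrightarrow>
     (\<exists>\<alpha> \<beta>. \<alpha> \<in> iso (G Mod upper_central G n) (H Mod upper_central H n) \<and>
        \<beta> \<in> iso (G\<lparr>carrier := lower_central G (n + 1)\<rparr>) (H\<lparr>carrier := lower_central H (n + 1)\<rparr>) \<and>
        (\<forall>gs hs. length gs = n + 1 \<longrightarrow> length hs = n + 1 \<longrightarrow>
           set gs \<subseteq> carrier G \<longrightarrow> set hs \<subseteq> carrier H \<longrightarrow>
           (\<forall>i < n + 1. \<alpha> (upper_central G n #>\<^bsub>G\<^esub> gs ! i) = upper_central H n #>\<^bsub>H\<^esub> hs ! i) \<longrightarrow>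
           \<beta> (iterated_commutator G gs) = iterated_commutator H hs))"


section \<open>Skew braces\<close>

record 'a brace =
  dot :: "'a monoid"
  circ :: "'a monoid"

definition skew_brace :: "'a brace \<Rightarrow> bool" where
  "skew_brace A \<longleftrightarrow> group (dot A) \<and> group (circ A) \<and> carrier (circ A) = carrier (dot A) \<and>
     (\<forall>a \<in> carrier (dot A). \<forall>b \<in> carrier (dot A). \<forall>c \<in> carrier (dot A).
        a \<otimes>\<^bsub>circ A\<^esub> (b \<otimes>\<^bsub>dot A\<^esub> c) =
        (a \<otimes>\<^bsub>circ A\<^esub> b) \<otimes>\<^bsub>dot A\<^esub> inv\<^bsub>dot A\<^esub> a \<otimes>\<^bsub>dot A\<^esub> (a \<otimes>\<^bsub>circ A\<^esub> c))"

definition symmetric_skew_brace :: "'a brace \<Rightarrow> bool" where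
  "symmetric_skew_brace A \<longleftrightarrow> skew_brace A \<and> skew_brace \<lparr>dot = circ A, circ = dot A\<rparr>"

lemma skew_brace_one_eq:
  assumes "skew_brace A"
  shows "\<one>\<^bsub>circ A\<^esub> = \<one>\<^bsub>dot A\<^esub>"
proof -
  interpret D: group "dot A" using assms by (simp add: skew_brace_def)
  interpret C: group "circ A" using assms by (simp add: skew_brace_def)
  have car: "carrier (circ A) = carrier (dot A)"
    using assms by (simp add: skew_brace_def)
  have e: "\<one>\<^bsub>circ A\<^esub> \<in> carrier (dot A)" using C.one_closed car by simp
  have "\<one>\<^bsub>circ A\<^esub> \<otimes>\<^bsub>circ A\<^esub> (\<one>\<^bsub>dot A\<^esub> \<otimes>\<^bsub>dot A\<^esub> \<one>\<^bsub>dot A\<^esub>) =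
    (\<one>\<^bsub>circ A\<^esub> \<otimes>\<^bsub>circ A\<^esub> \<one>\<^bsub>dot A\<^esub>) \<otimes>\<^bsub>dot A\<^esub> inv\<^bsub>dot A\<^esub> \<one>\<^bsub>circ A\<^esub> \<otimes>\<^bsub>dot A\<^esub>
    (\<one>\<^bsub>circ A\<^esub> \<otimes>\<^bsub>circ A\<^esub> \<one>\<^bsub>dot A\<^esub>)"
    using assms e D.one_closed unfolding skew_brace_def by blast
  then have "inv\<^bsub>dot A\<^esub> \<one>\<^bsub>circ A\<^esub> = \<one>\<^bsub>dot A\<^esub>"
    using e car by simp
  then show ?thesis using e by (metis D.inv_inv D.inv_one)
qed

definition brace_lambda :: "'a brace \<Rightarrow> 'a \<Rightarrow> 'a \<Rightarrow> 'a" where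
  "brace_lambda A a b = inv\<^bsub>dot A\<^esub> a \<otimes>\<^bsub>dot A\<^esub> (a \<otimes>\<^bsub>circ A\<^esub> b)"

definition brace_star :: "'a brace \<Rightarrow> 'a \<Rightarrow> 'a \<Rightarrow> 'a" where
  "brace_star A a b = brace_lambda A a b \<otimes>\<^bsub>dot A\<^esub> inv\<^bsub>dot A\<^esub> b"

definition brace_iso :: "'a brace \<Rightarrow> 'b brace \<Rightarrow> ('a \<Rightarrow> 'b) set" where
  "brace_iso A B = iso (dot A) (dot B) \<inter> iso (circ A) (circ B)"

text \<open>Only used for ideals \<open>I\<close>, for which the cosets of \<open>I\<close> in both groups coincide.\<close>

definition brace_quot :: "'a brace \<Rightarrow> 'a set \<Rightarrow> 'a set brace" where
  "brace_quot A I = \<lparr>dot = dot A Mod I, circ = circ A Mod I\<rparr>"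

definition sub_brace :: "'a brace \<Rightarrow> 'a set \<Rightarrow> 'a brace" where
  "sub_brace A S = \<lparr>dot = (dot A)\<lparr>carrier := S\<rparr>, circ = (circ A)\<lparr>carrier := S\<rparr>\<rparr>"

definition annihilator :: "'a brace \<Rightarrow> 'a set" where
  "annihilator A = {a \<in> carrier (dot A). \<forall>b \<in> carrier (dot A).
     brace_star A a b = \<one>\<^bsub>dot A\<^esub> \<and> brace_star A b a = \<one>\<^bsub>dot A\<^esub> \<and>
     commutator (dot A) a b = \<one>\<^bsub>dot A\<^esub>}"

primrec annihilator_series :: "'a brace \<Rightarrow> nat \<Rightarrow> 'a set" where
  "annihilator_series A 0 = {\<one>\<^bsub>dot A\<^esub>}"
| "annihilator_series A (Suc n) =
     {a \<in> carrier (dot A). annihilator_series A n #>\<^bsub>dot A\<^esub> a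
        \<in> annihilator (brace_quot A (annihilator_series A n))}"


section \<open>Commutator words and isoclinism of symmetric skew braces\<close>

datatype comm_symbol = Gamma | Gamma_bar | Star | Star_bar

text \<open>The free monoid on the symbols is \<open>comm_symbol list\<close>, and the degree is the length.\<close>

type_synonym comm_word = "comm_symbol list"

primrec symbol_value :: "'a brace \<Rightarrow> comm_symbol \<Rightarrow> 'a \<Rightarrow> 'a \<Rightarrow> 'a" where
  "symbol_value A Gamma a b = commutator (dot A) a b"
| "symbol_value A Gamma_bar a b = commutator (dot A) b a"
| "symbol_value A Star a b = brace_star A a b"
| "symbol_value A Star_bar a b = brace_star A b a"

text \<open>Meaningful for argument lists of length \<open>length m + 1\<close>; the empty word returns its
  single argument.\<close>

primrec word_value :: "'a brace \<Rightarrow> comm_word \<Rightarrow> 'a list \<Rightarrow> 'a" where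
  "word_value A [] as = hd as"
| "word_value A (e # m) as = symbol_value A e (hd as) (word_value A m (tl as))"

definition word_subgroup :: "'a brace \<Rightarrow> nat \<Rightarrow> 'a set" where
  "word_subgroup A t = generate (dot A)
     {word_value A m as | m as. t \<le> length m \<and> length as = length m + 1 \<and>
        set as \<subseteq> carrier (dot A)}"

text \<open>The map $\phi^A_m$ on tuples (lists of length \<open>length m + 1\<close>) of cosets: the common value
  of \<open>m\<close> on all tuples of representatives. For symmetric skew braces this value is unique.\<close>

definition word_map :: "'a brace \<Rightarrow> comm_word \<Rightarrow> 'a set list \<Rightarrow> 'a" where
  "word_map A m Xs = (THE y. \<exists>as. set as \<subseteq> carrier (dot A) \<and>
     Xs = map (\<lambda>a. annihilator_series A (length m) #>\<^bsub>dot A\<^esub> a) as \<and> y = word_value A m as)"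

definition brace_isoclinic :: "nat \<Rightarrow> 'a brace \<Rightarrow> 'b brace \<Rightarrow> bool" where
  "brace_isoclinic n A B \<longleftrightarrow>
     (\<exists>\<xi> \<theta>. \<xi> \<in> brace_iso (brace_quot A (annihilator_series A n))
                            (brace_quot B (annihilator_series B n)) \<and>
        \<theta> \<in> brace_iso (sub_brace A (word_subgroup A n)) (sub_brace B (word_subgroup B n)) \<and>
        (\<forall>m Xs. length m = n \<longrightarrow> length Xs = n + 1 \<longrightarrow>
           set Xs \<subseteq> carrier (dot (brace_quot A (annihilator_series A n))) \<longrightarrow>
           \<theta> (word_map A m Xs) = word_map B m (map \<xi> Xs)))"

end

theory Submission
  imports Defs
begin

text \<open>
The isoclinism gives an isomorphism \<open>\<xi>\<close> between \<open>A/Ann\<^sub>n(A)\<close> and \<open>B/Ann\<^sub>n(B)\<close> and an isomorphism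
\<open>\<theta>\<close> between \<open>A\<^sub>(\<^sub>n\<^sub>)\<close> and \<open>B\<^sub>(\<^sub>n\<^sub>)\<close> that respect the words of degree exactly \<open>n\<close>. Everything takes
place in the fibre product \<open>R\<close>, the set of pairs \<open>(a, b)\<close> with \<open>\<xi>(Ann\<^sub>n(A)a) = Ann\<^sub>n(B)b\<close>. It is
itself a symmetric skew brace, as a subbrace of \<open>A \<times> B\<close>, and it projects onto both factors. A word
of degree at least \<open>n\<close> is a word of degree \<open>n\<close> whose last argument is the value of a word, so the
hypothesis says that every generator of \<open>R\<^sub>(\<^sub>n\<^sub>)\<close> lies on the graph of \<open>\<theta>\<close>. The graph is a subgroup
for the operation \<open>\<cdot>\<close>, hence it contains \<open>R\<^sub>(\<^sub>n\<^sub>)\<close>.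

It therefore suffices that in a symmetric skew brace the right-normed commutators with \<open>n + 1\<close>
entries, in either group, lie in the subgroup of long words: \<open>\<theta>\<close> then carries the iterated
commutators of \<open>A\<close> to those of \<open>B\<close>. For \<open>\<cdot>\<close> they are values of the word \<open>\<gamma>\<^sup>n\<close>. For \<open>\<circ>\<close> this
holds because the subgroups of long words are ideals whose successive quotients are annihilated by
the whole brace, and elements of the annihilator are central for \<open>\<circ>\<close> as well
(\<open>circ_commutator_word_subgroup\<close>). Passing from \<open>R\<close> and \<open>\<theta>\<close> to an isoclinism is pure group theory
(\<open>group_isoclinicI\<close>): an element is in the \<open>n\<close>-th center exactly if every right-normed commutator
with \<open>n\<close> further entries ending in it is trivial, so \<open>R\<close> matches the two \<open>n\<close>-th centers and
induces an isomorphism of the central quotients, while \<open>\<theta>\<close> restricts to the lower central terms,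
which right-normed commutators generate.

One point needs work. The hypothesis on \<open>\<theta>\<close> speaks of the maps \<open>\<phi>\<^sub>m\<close>, so their well-definedness has
to be established: the value of a word of degree \<open>n\<close> depends only on the classes of its arguments
modulo \<open>Ann\<^sub>n\<close> (\<open>word_value_cong\<close>). This rests on the analogue of \<open>[Z\<^sub>n, \<gamma>\<^sub>k] \<le> Z\<^sub>n\<^sub>-\<^sub>k\<close>: a word value of
degree \<open>k\<close> commutes, in the sense of all the operations, with \<open>Ann\<^sub>i\<^sub>+\<^sub>k\<^sub>+\<^sub>1\<close> modulo \<open>Ann\<^sub>i\<close>
(\<open>word_value_commutes\<close>, whose induction step is \<open>commutes_step\<close>). The same statement for a group
follows by regarding it as a brace with equal operations.
\<close>

section \<open>Commutators in groups\<close>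

context group begin

lemma mult_inv_cancel:
  assumes "x \<in> carrier G" "y \<in> carrier G"
  shows "x \<otimes> (inv x \<otimes> y) = y" "inv x \<otimes> (x \<otimes> y) = y"
  using assms by (simp_all add: m_assoc[symmetric])

lemmas group_normalize = m_assoc inv_mult_group mult_inv_cancel

lemma commutator_closed [simp]:
  "a \<in> carrier G \<Longrightarrow> b \<in> carrier G \<Longrightarrow> commutator G a b \<in> carrier G"
  by (simp add: commutator_def)

lemma inv_commutator:
  "a \<in> carrier G \<Longrightarrow> b \<in> carrier G \<Longrightarrow> inv (commutator G a b) = commutator G b a"
  by (simp add: commutator_def group_normalize)

lemma commutator_one_right: "a \<in> carrier G \<Longrightarrow> commutator G a \<one> = \<one>"
  by (simp add: commutator_def)

lemma commutator_eq_one_iff: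
  assumes "a \<in> carrier G" "b \<in> carrier G"
  shows "commutator G a b = \<one> \<longleftrightarrow> a \<otimes> b = b \<otimes> a"
proof -
  have "commutator G a b = (a \<otimes> b) \<otimes> inv (b \<otimes> a)"
    using assms by (simp add: commutator_def group_normalize)
  then show ?thesis
    using assms by (metis inv_closed inv_equality inv_inv m_closed r_inv)
qed

lemma commutator_mult_right:
  assumes "a \<in> carrier G" "x \<in> carrier G" "y \<in> carrier G"
  shows "commutator G a (x \<otimes> y) = commutator G a x \<otimes> (x \<otimes> commutator G a y \<otimes> inv x)"
  using assms by (simp add: commutator_def group_normalize)

lemma commutator_inv_right:
  assumes "a \<in> carrier G" "x \<in> carrier G"
  shows "commutator G a (inv x) = inv x \<otimes> inv (commutator G a x) \<otimes> inv (inv x)"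
  using assms by (simp add: commutator_def group_normalize)

lemma conjugate_commutator:
  assumes "x \<in> carrier G" "a \<in> carrier G" "b \<in> carrier G"
  shows "x \<otimes> commutator G a b \<otimes> inv x =
    commutator G (x \<otimes> a \<otimes> inv x) (x \<otimes> b \<otimes> inv x)"
  using assms by (simp add: commutator_def group_normalize)

text \<open>The commutator with \<open>gu\<close> is \<open>g[u,y]g\<^sup>-\<^sup>1[g,y]\<close>, so a factor \<open>u\<close> that commutes with \<open>y\<close>
  disappears when it stands on the right of \<open>g\<close>.\<close>

lemma commutator_absorb:
  assumes "g \<in> carrier G" "u \<in> carrier G" "y \<in> carrier G" "u \<otimes> y = y \<otimes> u"
  shows "commutator G (g \<otimes> u) y = commutator G g y"
proof -
  have "u \<otimes> (y \<otimes> (inv u \<otimes> z)) = y \<otimes> z" if "z \<in> carrier G" for z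
    using assms that by (metis inv_closed m_assoc m_closed mult_inv_cancel(1))
  then show ?thesis
    using assms(1-3) by (simp add: commutator_def group_normalize)
qed

text \<open>Both identities \<open>[a,xy] = [a,x] x[a,y]x\<^sup>-\<^sup>1\<close> and \<open>[a,x\<^sup>-\<^sup>1] = x\<^sup>-\<^sup>1[a,x]\<^sup>-\<^sup>1x\<close>
  only produce conjugates of commutators with generators; a normal subgroup absorbs those.\<close>

lemma commutator_generate_normal:
  assumes N: "N \<lhd> G" and S: "S \<subseteq> carrier G" and a: "a \<in> carrier G"
    and comm: "\<And>s. s \<in> S \<Longrightarrow> commutator G a s \<in> N"
    and x: "x \<in> generate G S"
  shows "commutator G a x \<in> N"
proof -
  interpret N: normal N G by fact
  have mem: "y \<in> carrier G" if "y \<in> generate G S" for y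
    using that generate_in_carrier[OF S] by blast
  show ?thesis using x
  proof (induction x rule: generate.induct)
    case one
    show ?case using a by (simp add: commutator_one_right)
  next
    case (incl h)
    then show ?case by (rule comm)
  next
    case (inv h)
    then have "h \<in> carrier G" using S by blast
    then show ?case
      using N.inv_op_closed2[of "inv h" "inv (commutator G a h)"] comm[OF inv] a
      by (simp add: commutator_inv_right)
  next
    case (eng h1 h2)
    then show ?case
      using N.inv_op_closed2[of h1 "commutator G a h2"] mem a
      by (simp add: commutator_mult_right)
  qed
qed

lemma coset_eq_iff:
  assumes "subgroup N G" "a \<in> carrier G" "b \<in> carrier G"
  shows "N #> a = N #> b \<longleftrightarrow> a \<otimes> inv b \<in> N"
  using assms
  by (metis is_group repr_independence repr_independenceD rcos_self subgroup.rcos_module)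

lemma iterated_commutator_closed:
  "set gs \<subseteq> carrier G \<Longrightarrow> iterated_commutator G gs \<in> carrier G"
  by (induction G\<equiv>G gs rule: iterated_commutator.induct) simp_all

lemma conjugate_iterated_commutator:
  assumes "x \<in> carrier G" "set gs \<subseteq> carrier G"
  shows "x \<otimes> iterated_commutator G gs \<otimes> inv x =
    iterated_commutator G (map (\<lambda>g. x \<otimes> g \<otimes> inv x) gs)"
  using assms(2)
proof (induction G\<equiv>G gs rule: iterated_commutator.induct)
  case (3 g h gs)
  then show ?case
    using assms(1) iterated_commutator_closed[of "h # gs"]
    by (simp add: conjugate_commutator)
qed (use assms(1) in simp_all)

text \<open>The lower central series is spanned by the right-normed commutators, because the set of
  these commutators is closed under conjugation.\<close>

lemma lower_central_eq_generate:
  "lower_central G (Suc n) =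
    generate G {iterated_commutator G gs | gs. length gs = Suc n \<and> set gs \<subseteq> carrier G}"
proof (induction n)
  case 0
  have "{iterated_commutator G gs | gs. length gs = Suc 0 \<and> set gs \<subseteq> carrier G} = carrier G"
    by (force simp: length_Suc_conv intro: exI[of _ "[x]" for x])
  then show ?case
    using generate_is_subgroup[of "carrier G"] generate.incl[of _ "carrier G" G]
      subgroup.subset by fastforce
next
  case (Suc n)
  let ?S = "\<lambda>n. {iterated_commutator G gs | gs. length gs = Suc n \<and> set gs \<subseteq> carrier G}"
  have sub: "?S n \<subseteq> carrier G" for n
    using iterated_commutator_closed by blast
  have step: "commutator G g x \<in> ?S (Suc n)" if g: "g \<in> carrier G" and x: "x \<in> ?S n" for g x
  proof -
    obtain h hs where "x = iterated_commutator G (h # hs)" "length hs = n"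
      "set (h # hs) \<subseteq> carrier G"
      using x by (auto simp: length_Suc_conv)
    then show ?thesis
      using g by (auto intro!: exI[of _ "g # h # hs"])
  qed
  have norm: "generate G (?S (Suc n)) \<lhd> G"
  proof (rule normal_generateI[OF sub])
    fix h g assume "h \<in> ?S (Suc n)" "g \<in> carrier G"
    then obtain gs where "h = iterated_commutator G gs" "length gs = Suc (Suc n)"
      "set gs \<subseteq> carrier G" by blast
    moreover from this \<open>g \<in> carrier G\<close>
    have "set (map (\<lambda>x. g \<otimes> x \<otimes> inv g) gs) \<subseteq> carrier G" by auto
    ultimately show "g \<otimes> h \<otimes> inv g \<in> ?S (Suc n)"
      using \<open>g \<in> carrier G\<close> conjugate_iterated_commutator
      by (intro CollectI exI[of _ "map (\<lambda>x. g \<otimes> x \<otimes> inv g) gs"]) simp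
  qed
  let ?C = "{commutator G g x | g x. g \<in> carrier G \<and> x \<in> lower_central G (Suc n)}"
  have "?C \<subseteq> generate G (?S (Suc n))"
  proof clarify
    fix g x assume g: "g \<in> carrier G" and x: "x \<in> lower_central G (Suc n)"
    show "commutator G g x \<in> generate G (?S (Suc n))"
      by (rule commutator_generate_normal[OF norm sub g _ x[unfolded Suc]])
        (rule generate.incl[OF step[OF g]])
  qed
  moreover have "?S (Suc n) \<subseteq> ?C"
  proof clarify
    fix gs assume gs: "length gs = Suc (Suc n)" "set gs \<subseteq> carrier G"
    then obtain g h hs where "gs = g # h # hs" by (auto simp: length_Suc_conv)
    with gs have "iterated_commutator G gs = commutator G g (iterated_commutator G (h # hs))"
      "iterated_commutator G (h # hs) \<in> ?S n" "g \<in> carrier G"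
      by (auto intro!: exI[of _ "h # hs"])
    then show "\<exists>g x. iterated_commutator G gs = commutator G g x \<and> g \<in> carrier G \<and>
        x \<in> lower_central G (Suc n)"
      unfolding Suc by (blast intro: generate.incl)
  qed
  ultimately have "generate G ?C = generate G (?S (Suc n))"
    by (intro equalityI generate_subgroup_incl[OF _ normal_imp_subgroup[OF norm]] mono_generate)
  then show ?case by simp
qed

text \<open>The two innermost entries of a right-normed commutator form a commutator; inductions along
  the upper central series peel off entries from this end.\<close>

lemma iterated_commutator_snoc:
  "iterated_commutator G (xs @ [x, z]) =
    iterated_commutator G (xs @ [commutator G x z])"
proof (induction xs)
  case (Cons a xs)
  then show ?case by (cases xs) auto
qed simp

end

lemma (in group_hom) hom_commutator:
  "a \<in> carrier G \<Longrightarrow> b \<in> carrier G \<Longrightarrow>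
    h (commutator G a b) = commutator H (h a) (h b)"
  by (simp add: commutator_def)

lemma (in group_hom) hom_iterated_commutator:
  "set gs \<subseteq> carrier G \<Longrightarrow>
    h (iterated_commutator G gs) = iterated_commutator H (map h gs)"
proof (induction G\<equiv>G gs rule: iterated_commutator.induct)
  case (3 g k gs)
  then show ?case
    using G.iterated_commutator_closed[of "k # gs"] by (simp add: hom_commutator)
qed simp_all

lemma (in group_hom) normal_preimage:
  assumes "N \<lhd> H"
  shows "{g \<in> carrier G. h g \<in> N} \<lhd> G"
proof -
  interpret N: normal N H by fact
  show ?thesis
  proof (rule G.normal_invI)
    show "subgroup {g \<in> carrier G. h g \<in> N} G"
      by (rule G.subgroupI) (auto intro: exI[of _ \<one>] simp: N.one_closed)
  qed (auto simp: N.inv_op_closed2)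
qed

section \<open>Groups acting on themselves\<close>

text \<open>A symmetric skew brace is encoded by its group \<open>\<cdot>\<close> and the map \<open>\<lambda>\<close>, from which
\<open>a \<circ> b = a \<cdot> \<lambda>\<^sub>a(b)\<close> is recovered. In this form all computations take place in one group. The last
assumption says that \<open>\<lambda>\<close> is a homomorphism on \<open>(A,\<circ>)\<close>, which holds in every skew brace. The
one before it, that \<open>\<lambda>\<close> reverses the order on \<open>(A,\<cdot>)\<close>, expresses symmetry.\<close>

locale lambda_group = group G for G (structure) +
  fixes lam :: "'a \<Rightarrow> 'a \<Rightarrow> 'a"
  assumes lam_closed [simp]: "a \<in> carrier G \<Longrightarrow> b \<in> carrier G \<Longrightarrow> lam a b \<in> carrier G"
    and lam_mult: "\<lbrakk>a \<in> carrier G; b \<in> carrier G; c \<in> carrier G\<rbrakk> \<Longrightarrow>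
      lam a (b \<otimes> c) = lam a b \<otimes> lam a c"
    and lam_one [simp]: "b \<in> carrier G \<Longrightarrow> lam \<one> b = b"
    and lam_of_mult: "\<lbrakk>a \<in> carrier G; b \<in> carrier G; c \<in> carrier G\<rbrakk> \<Longrightarrow>
      lam (a \<otimes> b) c = lam b (lam a c)"
    and lam_of_circ: "\<lbrakk>a \<in> carrier G; b \<in> carrier G; c \<in> carrier G\<rbrakk> \<Longrightarrow>
      lam (a \<otimes> lam a b) c = lam a (lam b c)"
begin

definition star :: "'a \<Rightarrow> 'a \<Rightarrow> 'a" where
  "star a b = lam a b \<otimes> inv b"

text \<open>The four products \<open>z \<cdot> y\<close>, \<open>y \<cdot> z\<close>, \<open>z \<circ> y\<close> and \<open>y \<circ> z\<close> agree.\<close>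

definition commutes :: "'a \<Rightarrow> 'a \<Rightarrow> bool" where
  "commutes z y \<longleftrightarrow> z \<otimes> y = y \<otimes> z \<and> lam z y = y \<and> lam y z = z"

lemma star_closed [simp]: "a \<in> carrier G \<Longrightarrow> b \<in> carrier G \<Longrightarrow> star a b \<in> carrier G"
  by (simp add: star_def)

lemma lam_inv_cancel [simp]:
  assumes "a \<in> carrier G" "b \<in> carrier G"
  shows "lam (inv a) (lam a b) = b" "lam a (lam (inv a) b) = b"
  using assms lam_of_mult[of a "inv a" b] lam_of_mult[of "inv a" a b] by simp_all

lemma lam_at_one [simp]: "a \<in> carrier G \<Longrightarrow> lam a \<one> = \<one>"
  by (metis lam_closed lam_mult one_closed r_cancel_one' r_one)

lemma lam_inv: "a \<in> carrier G \<Longrightarrow> b \<in> carrier G \<Longrightarrow> lam a (inv b) = inv (lam a b)"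
  by (metis inv_closed inv_equality l_inv lam_at_one lam_closed lam_mult)

text \<open>Symmetry makes every \<open>\<lambda>\<^sub>a\<close> an automorphism of both groups: compare the action of
  \<open>a \<cdot> \<lambda>\<^sub>a(b) = a \<circ> b\<close> computed in the two ways.\<close>

lemma lam_of_lam:
  assumes "a \<in> carrier G" "b \<in> carrier G" "c \<in> carrier G"
  shows "lam (lam a b) (lam a c) = lam a (lam b c)"
  using assms lam_of_mult[of a "lam a b" c] lam_of_circ[of a b c] by simp

lemma lam_of_lam':
  assumes "a \<in> carrier G" "b \<in> carrier G" "c \<in> carrier G"
  shows "lam (lam a b) c = lam a (lam b (lam (inv a) c))"
  using lam_of_lam[of a b "lam (inv a) c"] assms by simp

lemma lam_star:
  assumes "a \<in> carrier G" "b \<in> carrier G" "c \<in> carrier G"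
  shows "lam a (star b c) = star (lam a b) (lam a c)"
  using assms by (simp add: star_def lam_mult lam_inv lam_of_lam)

lemma lam_commutator:
  assumes "a \<in> carrier G" "b \<in> carrier G" "c \<in> carrier G"
  shows "lam a (commutator G b c) = commutator G (lam a b) (lam a c)"
  using assms by (simp add: commutator_def lam_mult lam_inv)

lemma lam_eq_star_mult:
  "a \<in> carrier G \<Longrightarrow> b \<in> carrier G \<Longrightarrow> lam a b = star a b \<otimes> b"
  by (simp add: star_def m_assoc)

lemma star_eq_one_iff:
  "a \<in> carrier G \<Longrightarrow> b \<in> carrier G \<Longrightarrow> star a b = \<one> \<longleftrightarrow> lam a b = b"
  unfolding star_def by (metis inv_closed inv_equality inv_inv lam_closed r_inv)

lemma commutes_iff:
  assumes "a \<in> carrier G" "b \<in> carrier G"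
  shows "commutes a b \<longleftrightarrow> star a b = \<one> \<and> star b a = \<one> \<and> commutator G a b = \<one>"
  using assms by (auto simp: commutes_def star_eq_one_iff commutator_eq_one_iff)

lemma commutes_sym: "commutes z y \<longleftrightarrow> commutes y z"
  by (auto simp: commutes_def)

lemma commutes_inv:
  assumes "z \<in> carrier G" "y \<in> carrier G" "commutes z y"
  shows "commutes z (inv y)"
proof -
  have "lam (inv y) z = z"
    using assms lam_inv_cancel(1)[of y z] by (simp add: commutes_def)
  moreover have "z \<otimes> inv y = inv y \<otimes> z"
  proof -
    have "z \<otimes> inv y = inv y \<otimes> (y \<otimes> z) \<otimes> inv y"
      using assms by (simp add: group_normalize)
    also have "y \<otimes> z = z \<otimes> y"
      using assms by (simp add: commutes_def)
    also have "inv y \<otimes> (z \<otimes> y) \<otimes> inv y = inv y \<otimes> z"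
      using assms by (simp add: group_normalize)
    finally show ?thesis .
  qed
  ultimately show ?thesis
    using assms by (simp add: commutes_def lam_inv)
qed

text \<open>An argument may be changed by an element commuting with the other argument, on the side
  on which the operation absorbs it.\<close>

lemma star_absorb_left:
  assumes "u \<in> carrier G" "g \<in> carrier G" "y \<in> carrier G" "commutes u y"
  shows "star (u \<otimes> g) y = star g y"
  using assms by (simp add: star_def lam_of_mult commutes_def)

lemma star_absorb_right:
  assumes "u \<in> carrier G" "g \<in> carrier G" "y \<in> carrier G" "commutes u y"
  shows "star y (g \<otimes> u) = star y g"
  using assms by (simp add: star_def lam_mult commutes_def group_normalize)

lemma star_mult_right:
  assumes "a \<in> carrier G" "x \<in> carrier G" "y \<in> carrier G"
  shows "star a (x \<otimes> y) = star a x \<otimes> (x \<otimes> star a y \<otimes> inv x)"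
  using assms by (simp add: star_def lam_mult group_normalize)

lemma star_inv_right:
  assumes "a \<in> carrier G" "x \<in> carrier G"
  shows "star a (inv x) = inv x \<otimes> inv (star a x) \<otimes> inv (inv x)"
  using assms by (simp add: star_def lam_inv group_normalize)

lemma star_mult_left:
  assumes "a \<in> carrier G" "x \<in> carrier G" "y \<in> carrier G"
  shows "star (x \<otimes> y) a = lam y (star x a) \<otimes> star y a"
  using assms by (simp add: star_def lam_mult lam_inv lam_of_mult group_normalize)

lemma star_inv_left:
  assumes "a \<in> carrier G" "x \<in> carrier G"
  shows "star (inv x) a = lam (inv x) (inv (star x a))"
proof -
  have "inv (star x a) = a \<otimes> inv (lam x a)"
    using assms by (simp add: star_def group_normalize)
  then show ?thesis
    using assms by (simp add: lam_mult lam_inv star_def)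
qed

text \<open>This is the annihilator of the brace.\<close>

definition center :: "'a set" where
  "center = {v \<in> carrier G. \<forall>b \<in> carrier G. commutes v b}"

lemma center_normal: "center \<lhd> G"
proof (rule normal_invI)
  show "subgroup center G"
  proof (rule subgroupI)
    show "center \<subseteq> carrier G" by (auto simp: center_def)
    show "center \<noteq> {}"
      by (auto simp: center_def commutes_def intro!: exI[of _ \<one>])
    show "inv a \<in> center" if "a \<in> center" for a
      using that commutes_inv commutes_sym by (auto simp: center_def)
    show "a \<otimes> b \<in> center" if "a \<in> center" "b \<in> center" for a b
    proof -
      have ab: "a \<in> carrier G" "b \<in> carrier G"
        and "\<And>c. c \<in> carrier G \<Longrightarrow> commutes a c" "\<And>c. c \<in> carrier G \<Longrightarrow> commutes b c"
        using that by (auto simp: center_def)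
      then have "commutes (a \<otimes> b) c" if "c \<in> carrier G" for c
        using that unfolding commutes_def by (metis lam_mult lam_of_mult m_assoc)
      then show ?thesis
        using ab by (simp add: center_def)
    qed
  qed
  show "x \<otimes> h \<otimes> inv x \<in> center" if "x \<in> carrier G" "h \<in> center" for x h
  proof -
    have h: "h \<in> carrier G" and "x \<otimes> h = h \<otimes> x"
      using that by (auto simp: center_def commutes_def)
    then have "x \<otimes> h \<otimes> inv x = h"
      using that(1) by (simp add: m_assoc)
    then show ?thesis using that by simp
  qed
qed

text \<open>The induction step of the analogue of \<open>[Z\<^sub>n, \<gamma>\<^sub>k] \<le> Z\<^sub>n\<^sub>-\<^sub>k\<close>, after passing to the quotient by the
last term. Here \<open>Z\<close> and \<open>U\<close> play the role of two consecutive terms of the annihilator series, and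
\<open>y\<close> is a word value that commutes with \<open>U\<close> and commutes with \<open>Z\<close> up to central elements.

Let \<open>c\<close> be one of the four values formed from \<open>g\<close> and \<open>y\<close>. Applying \<open>\<lambda>\<^sub>z\<close>, or conjugating by \<open>z\<close>,
changes \<open>g\<close> by a factor in \<open>U\<close> and \<open>y\<close> by a central factor, and \<open>c\<close> absorbs both. For the
remaining equation \<open>\<lambda>\<^sub>c(z) = z\<close>, the map \<open>\<lambda>\<^sub>c\<close> is a group commutator of \<open>\<lambda>\<^sub>g\<close> and \<open>\<lambda>\<^sub>y\<close> or their
inverses, and these two maps commute on \<open>Z\<close>.\<close>

lemma commutes_step:
  assumes U: "U \<subseteq> carrier G" and Z: "Z \<subseteq> carrier G"
    and g: "g \<in> carrier G" and y: "y \<in> carrier G"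
    and U_conj: "\<And>u x. u \<in> U \<Longrightarrow> x \<in> carrier G \<Longrightarrow> x \<otimes> u \<otimes> inv x \<in> U"
    and Z_lam: "\<And>z x. z \<in> Z \<Longrightarrow> x \<in> carrier G \<Longrightarrow> lam x z \<in> Z"
    and ZU: "\<And>z x. z \<in> Z \<Longrightarrow> x \<in> carrier G \<Longrightarrow>
      commutator G z x \<in> U \<and> star z x \<in> U \<and> star x z \<in> U"
    and Uy: "\<And>u. u \<in> U \<Longrightarrow> commutes u y"
    and Zy: "\<And>z. z \<in> Z \<Longrightarrow> commutator G z y \<in> center \<and> star z y \<in> center \<and> star y z \<in> center"
    and z: "z \<in> Z"
  shows "commutes z (commutator G g y)" "commutes z (commutator G y g)"
    and "commutes z (star g y)" "commutes z (star y g)"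
proof -
  note mem [simp] = g y
  have Zc [simp]: "x \<in> carrier G" if "x \<in> Z" for x using that Z by blast
  have Uc [simp]: "x \<in> carrier G" if "x \<in> U" for x using that U by blast
  have zc [simp]: "z \<in> carrier G" using z by simp
  have Cc [simp]: "x \<in> carrier G" if "x \<in> center" for x using that by (simp add: center_def)
  have Ccomm: "commutes v x" if "v \<in> center" "x \<in> carrier G" for v x
    using that unfolding center_def by blast
  have U_right: "\<exists>u' \<in> U. u \<otimes> x = x \<otimes> u'" if "u \<in> U" "x \<in> carrier G" for u x
    using U_conj[of u "inv x"] that
    by (intro bexI[of _ "inv x \<otimes> u \<otimes> inv (inv x)"]) (auto simp: group_normalize)
  \<comment> \<open>The action of \<open>z\<close> moves \<open>g\<close> by \<open>U\<close> and \<open>y\<close> by the center, on either side.\<close>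
  define u where "u = star z g"
  define v where "v = star z y"
  have u: "u \<in> U" "lam z g = u \<otimes> g" and v: "v \<in> center" "lam z y = v \<otimes> y"
    using ZU[OF z g] Zy[OF z] by (auto simp: u_def v_def lam_eq_star_mult[of z])
  obtain u' where u': "u' \<in> U" "lam z g = g \<otimes> u'"
    using U_right[OF u(1) g] u(2) by auto
  have v': "lam z y = y \<otimes> v" using v Ccomm[of v y] by (simp add: commutes_def)
  define w where "w = commutator G z g"
  define t where "t = commutator G z y"
  have w: "w \<in> U" "z \<otimes> g \<otimes> inv z = w \<otimes> g"
    and t: "t \<in> center" "z \<otimes> y \<otimes> inv z = t \<otimes> y"
    using ZU[OF z g] Zy[OF z] by (auto simp: w_def t_def commutator_def group_normalize)
  obtain w' where w': "w' \<in> U" "z \<otimes> g \<otimes> inv z = g \<otimes> w'"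
    using U_right[OF w(1) g] w(2) by auto
  have t': "z \<otimes> y \<otimes> inv z = y \<otimes> t" using t Ccomm[of t y] by (simp add: commutes_def)
  have conj_eq: "z \<otimes> c = c \<otimes> z" if "c \<in> carrier G" "z \<otimes> c \<otimes> inv z = c" for c
    using that by (metis inv_closed inv_solve_right m_closed zc)
  have comm_vy: "commutator G x (y \<otimes> s) = commutator G x y"
    if "s \<in> center" "x \<in> carrier G" for s x
  proof -
    have "commutator G (y \<otimes> s) x = commutator G y x"
      using that Ccomm[of s x] by (intro commutator_absorb) (auto simp: commutes_def)
    then show ?thesis
      using that by (metis Cc inv_commutator m_closed y)
  qed
  \<comment> \<open>The actions of \<open>g\<close> and \<open>y\<close> on \<open>Z\<close> commute.\<close>
  have lam_lam: "lam g (lam y x) = lam y (lam g x)" if x: "x \<in> Z" for x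
  proof -
    define s where "s = star y x"
    define r where "r = star g x"
    have s: "s \<in> center" "lam y x = s \<otimes> x" and r: "r \<in> U" "lam g x = r \<otimes> x"
      using Zy[OF x] ZU[OF x g] x by (auto simp: s_def r_def lam_eq_star_mult)
    have "lam g (lam y x) = s \<otimes> (r \<otimes> x)"
      using s r x Ccomm[of s g] by (simp add: lam_mult commutes_def)
    moreover have "lam y (lam g x) = r \<otimes> (s \<otimes> x)"
      using s r x Uy[of r] by (simp add: lam_mult commutes_def)
    moreover have "s \<otimes> r = r \<otimes> s" using s r Ccomm[of s r] by (simp add: commutes_def)
    ultimately show ?thesis using s r x by (simp add: m_assoc[symmetric])
  qed
  have swap: "lam (inv g) (lam y (lam g x)) = lam y x"
    "lam (inv y) (lam g (lam y x)) = lam g x" if "x \<in> Z" for x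
    using that lam_inv_cancel(1)[of g "lam y x"] lam_inv_cancel(1)[of y "lam g x"]
    by (simp_all add: lam_lam del: lam_inv_cancel)
  show comm: "commutes z (commutator G g y)"
    unfolding commutes_def
  proof (intro conjI)
    have "z \<otimes> commutator G g y \<otimes> inv z = commutator G (g \<otimes> w') (y \<otimes> t)"
      by (simp add: conjugate_commutator w' t')
    also have "\<dots> = commutator G g y"
      using w' t Uy[of w'] by (simp add: comm_vy commutator_absorb commutes_def)
    finally show "z \<otimes> commutator G g y = commutator G g y \<otimes> z"
      by (intro conj_eq) simp_all
    have "lam z (commutator G g y) = commutator G (g \<otimes> u') (y \<otimes> v)"
      by (simp add: lam_commutator u' v')
    also have "\<dots> = commutator G g y"
      using u' v Uy[of u'] by (simp add: comm_vy commutator_absorb commutes_def)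
    finally show "lam z (commutator G g y) = commutator G g y" .
    have "lam (commutator G g y) z = lam (inv y) (lam (inv g) (lam y (lam g z)))"
      by (simp add: commutator_def lam_of_mult)
    then show "lam (commutator G g y) z = z"
      by (simp add: swap(1)[OF z])
  qed
  then show "commutes z (commutator G y g)"
    using commutes_inv[OF zc _ comm] by (simp add: inv_commutator)
  show "commutes z (star g y)"
    unfolding commutes_def
  proof (intro conjI)
    \<comment> \<open>Conjugation by \<open>z\<close> passes through \<open>lam g\<close> as conjugation by \<open>z'\<close>, which moves \<open>y\<close> by
      the same central element.\<close>
    define z' where "z' = lam (inv g) z"
    define r where "r = star (inv g) z"
    have z': "z' \<in> Z" "z' = r \<otimes> z" "r \<in> U"
      using z Z_lam[OF z, of "inv g"] ZU[OF z, of "inv g"]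
      by (auto simp: z'_def r_def lam_eq_star_mult)
    have "z' \<otimes> y \<otimes> inv z' = r \<otimes> (z \<otimes> y \<otimes> inv z) \<otimes> inv r"
      using z' by (simp add: group_normalize)
    also have "\<dots> = r \<otimes> y \<otimes> inv r \<otimes> (r \<otimes> t \<otimes> inv r)"
      using z' t(1) by (simp add: t' group_normalize)
    also have "\<dots> = y \<otimes> t"
    proof -
      have "r \<otimes> y = y \<otimes> r" "r \<otimes> t = t \<otimes> r"
        using z' t(1) Uy[of r] Ccomm[of t r] by (simp_all add: commutes_def)
      then show ?thesis
        using z' t(1) by (simp add: m_assoc)
    qed
    finally have conj: "z' \<otimes> y \<otimes> inv z' = t \<otimes> y" using t t' by simp
    have zz': "z = lam g z'" by (simp add: z'_def)
    have "z \<otimes> star g y \<otimes> inv z = z \<otimes> lam g y \<otimes> inv z \<otimes> inv (z \<otimes> y \<otimes> inv z)"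
      by (simp add: star_def group_normalize)
    also have "z \<otimes> lam g y \<otimes> inv z = lam g (z' \<otimes> y \<otimes> inv z')"
      using z'(1) zz' by (simp add: lam_mult lam_inv del: lam_inv_cancel)
    also have "\<dots> = t \<otimes> lam g y"
      using t Ccomm[of t g] by (simp add: conj lam_mult commutes_def)
    also have "t \<otimes> lam g y = lam g y \<otimes> t" using t Ccomm[of t "lam g y"] by (simp add: commutes_def)
    finally have "z \<otimes> star g y \<otimes> inv z = star g y"
      using t by (simp add: t' star_def group_normalize)
    moreover have "y \<otimes> t = t \<otimes> y" using t t' by simp
    ultimately show "z \<otimes> star g y = star g y \<otimes> z"
      by (intro conj_eq) simp_all
    have "lam z (star g y) = star (u \<otimes> g) (y \<otimes> v)"
      using u by (simp add: lam_star v')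
    also have "\<dots> = star g y"
      using u v Ccomm[of v "u \<otimes> g"] Uy[of u] by (simp add: star_absorb_left star_absorb_right)
    finally show "lam z (star g y) = star g y" .
    have "lam (star g y) z = lam (inv y) (lam g (lam y (lam (inv g) z)))"
      by (simp add: star_def lam_of_mult lam_of_lam')
    then show "lam (star g y) z = z"
      by (simp add: swap(2)[OF Z_lam] z)
  qed
  show "commutes z (star y g)"
    unfolding commutes_def
  proof (intro conjI)
    \<comment> \<open>Since \<open>lam y z\<close> differs from \<open>z\<close> by a central element, it conjugates in the same way;
      so conjugating \<open>lam y g\<close> by \<open>z\<close> is applying \<open>lam y\<close> to a conjugate of \<open>g\<close>.\<close>
    define s where "s = star y z"
    have s: "s \<in> center" "lam y z = s \<otimes> z" using Zy[OF z] by (auto simp: s_def lam_eq_star_mult)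
    have z_eq: "lam y z = z \<otimes> s" using s Ccomm[of s z] by (simp add: commutes_def)
    have "s \<otimes> (z \<otimes> lam y g \<otimes> inv z) = z \<otimes> lam y g \<otimes> inv z \<otimes> s"
      using s Ccomm[of s "z \<otimes> lam y g \<otimes> inv z"] by (simp add: commutes_def)
    then have "z \<otimes> lam y g \<otimes> inv z = s \<otimes> (z \<otimes> lam y g \<otimes> inv z) \<otimes> inv s"
      using s(1) by (simp add: group_normalize)
    also have "\<dots> = s \<otimes> z \<otimes> lam y g \<otimes> inv (s \<otimes> z)"
      using s(1) by (simp add: group_normalize)
    also have "\<dots> = lam y (z \<otimes> g \<otimes> inv z)"
      using s by (simp add: lam_mult lam_inv)
    also have "\<dots> = lam y g \<otimes> w'"
      using w' Uy[of w'] by (simp add: lam_mult commutes_def)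
    finally have "z \<otimes> lam y g \<otimes> inv z = lam y g \<otimes> w'" .
    moreover have "z \<otimes> star y g \<otimes> inv z = z \<otimes> lam y g \<otimes> inv z \<otimes> inv (z \<otimes> g \<otimes> inv z)"
      by (simp add: star_def group_normalize)
    ultimately have "z \<otimes> star y g \<otimes> inv z = star y g"
      using w' by (simp add: star_def group_normalize)
    then show "z \<otimes> star y g = star y g \<otimes> z"
      by (intro conj_eq) simp_all
    have "lam z (star y g) = star (v \<otimes> y) (g \<otimes> u')"
      using u' v by (simp add: lam_star)
    also have "\<dots> = star y g"
      using u' v Ccomm[of v "g \<otimes> u'"] Uy[of u'] by (simp add: star_absorb_left star_absorb_right)
    finally show "lam z (star y g) = star y g" .
    have "lam (star y g) z = lam (inv g) (lam y (lam g (lam (inv y) z)))"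
      by (simp add: star_def lam_of_mult lam_of_lam')
    then show "lam (star y g) z = z"
      by (simp add: swap(1)[OF Z_lam] z)
  qed
qed

text \<open>A multiplier in a normal subgroup can be written on either side of \<open>g\<close>, hence on the side on
  which each of the four operations absorbs it.\<close>

lemma coset_absorb:
  assumes N: "N \<lhd> G" and comm: "\<And>u. u \<in> N \<Longrightarrow> commutes u y"
    and c: "g \<in> carrier G" "g' \<in> carrier G" "y \<in> carrier G" and g': "g' \<otimes> inv g \<in> N"
  shows "commutator G g' y = commutator G g y" "commutator G y g' = commutator G y g"
    and "star g' y = star g y" "star y g' = star y g"
proof -
  interpret N: normal N G by fact
  define u where "u = g' \<otimes> inv g"
  define u' where "u' = inv g \<otimes> u \<otimes> g"
  have u: "u \<in> N" "u \<in> carrier G" "g' = u \<otimes> g"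
    using g' c by (auto simp: u_def m_assoc)
  have u': "u' \<in> N" "u' \<in> carrier G" "g' = g \<otimes> u'"
    using N.inv_op_closed1[of g u] u c by (auto simp: u'_def group_normalize)
  show "commutator G g' y = commutator G g y"
    using u' c comm[of u'] by (simp add: commutator_absorb commutes_def)
  then show "commutator G y g' = commutator G y g"
    using c by (metis inv_commutator)
  show "star g' y = star g y"
    using u c comm[of u] by (simp add: star_absorb_left)
  show "star y g' = star y g"
    using u' c comm[of u'] by (simp add: star_absorb_right)
qed

text \<open>The \<open>*\<close>-version of \<open>commutator_generate_normal\<close>. In the left argument products are moved by
  \<open>\<lambda>\<close>, whence the invariance required of \<open>N\<close>.\<close>

lemma star_generate_normal:
  assumes N: "N \<lhd> G" and N_lam: "\<And>x n. x \<in> carrier G \<Longrightarrow> n \<in> N \<Longrightarrow> lam x n \<in> N"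
    and S: "S \<subseteq> carrier G" and a: "a \<in> carrier G"
    and gen: "\<And>s. s \<in> S \<Longrightarrow> star a s \<in> N \<and> star s a \<in> N"
    and x: "x \<in> generate G S"
  shows "star a x \<in> N \<and> star x a \<in> N"
proof -
  interpret N: normal N G by fact
  have mem: "y \<in> carrier G" if "y \<in> generate G S" for y
    using that generate_in_carrier[OF S] by blast
  show ?thesis using x
  proof (induction x rule: generate.induct)
    case one
    show ?case using a by (simp add: star_def)
  next
    case (incl h)
    then show ?case by (rule gen)
  next
    case (inv h)
    then have "h \<in> carrier G" using S by blast
    then show ?case
      using N.inv_op_closed2[of "inv h" "inv (star a h)"] gen[OF inv] a
      by (simp add: star_inv_right star_inv_left N_lam)
  next
    case (eng h1 h2)
    then show ?case
      using N.inv_op_closed2[of h1 "star a h2"] mem a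
      by (simp add: star_mult_right star_mult_left N_lam)
  qed
qed

end

section \<open>Symmetric skew braces\<close>

context
  fixes A :: "'a brace"
  assumes skew: "skew_brace A"
begin

interpretation D: group "dot A" using skew by (simp add: skew_brace_def)
interpretation C: group "circ A" using skew by (simp add: skew_brace_def)

lemma skew_brace_carrier: "carrier (circ A) = carrier (dot A)"
  using skew by (simp add: skew_brace_def)

lemma skew_brace_circ_closed:
  "a \<in> carrier (dot A) \<Longrightarrow> b \<in> carrier (dot A) \<Longrightarrow> a \<otimes>\<^bsub>circ A\<^esub> b \<in> carrier (dot A)"
  using C.m_closed by (simp add: skew_brace_carrier)

lemma brace_lambda_closed:
  "a \<in> carrier (dot A) \<Longrightarrow> b \<in> carrier (dot A) \<Longrightarrow> brace_lambda A a b \<in> carrier (dot A)"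
  by (simp add: brace_lambda_def skew_brace_circ_closed)

lemma circ_eq_lambda:
  "a \<in> carrier (dot A) \<Longrightarrow> b \<in> carrier (dot A) \<Longrightarrow>
    a \<otimes>\<^bsub>circ A\<^esub> b = a \<otimes>\<^bsub>dot A\<^esub> brace_lambda A a b"
  by (simp add: brace_lambda_def skew_brace_circ_closed D.mult_inv_cancel)

lemma brace_lambda_mult:
  assumes "a \<in> carrier (dot A)" "b \<in> carrier (dot A)" "c \<in> carrier (dot A)"
  shows "brace_lambda A a (b \<otimes>\<^bsub>dot A\<^esub> c) =
    brace_lambda A a b \<otimes>\<^bsub>dot A\<^esub> brace_lambda A a c"
proof -
  have "a \<otimes>\<^bsub>circ A\<^esub> (b \<otimes>\<^bsub>dot A\<^esub> c) =
      (a \<otimes>\<^bsub>circ A\<^esub> b) \<otimes>\<^bsub>dot A\<^esub> inv\<^bsub>dot A\<^esub> a \<otimes>\<^bsub>dot A\<^esub> (a \<otimes>\<^bsub>circ A\<^esub> c)"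
    using skew assms by (simp add: skew_brace_def)
  then show ?thesis
    using assms by (simp add: brace_lambda_def skew_brace_circ_closed D.m_assoc)
qed

lemma brace_lambda_circ:
  assumes "a \<in> carrier (dot A)" "b \<in> carrier (dot A)" "c \<in> carrier (dot A)"
  shows "brace_lambda A (a \<otimes>\<^bsub>circ A\<^esub> b) c = brace_lambda A a (brace_lambda A b c)"
proof -
  have "(a \<otimes>\<^bsub>circ A\<^esub> b) \<otimes>\<^bsub>circ A\<^esub> c = a \<otimes>\<^bsub>circ A\<^esub> (b \<otimes>\<^bsub>dot A\<^esub> brace_lambda A b c)"
    using assms C.m_assoc[of a b c] by (simp add: skew_brace_carrier circ_eq_lambda)
  also have "\<dots> = a \<otimes>\<^bsub>dot A\<^esub> brace_lambda A a b \<otimes>\<^bsub>dot A\<^esub> brace_lambda A a (brace_lambda A b c)"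
    using assms by (simp add: circ_eq_lambda brace_lambda_mult brace_lambda_closed D.m_assoc)
  also have "a \<otimes>\<^bsub>dot A\<^esub> brace_lambda A a b = a \<otimes>\<^bsub>circ A\<^esub> b"
    using assms by (simp add: circ_eq_lambda)
  finally show ?thesis
    using assms
    by (simp add: brace_lambda_def[of A "a \<otimes>\<^bsub>circ A\<^esub> b"] skew_brace_circ_closed
        brace_lambda_closed D.mult_inv_cancel)
qed

lemma brace_lambda_one: "b \<in> carrier (dot A) \<Longrightarrow> brace_lambda A \<one>\<^bsub>dot A\<^esub> b = b"
proof -
  assume b: "b \<in> carrier (dot A)"
  then have "\<one>\<^bsub>dot A\<^esub> \<otimes>\<^bsub>circ A\<^esub> b = b"
    using C.l_one[of b] by (simp add: skew_brace_carrier skew_brace_one_eq[OF skew])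
  then show ?thesis using b by (simp add: brace_lambda_def)
qed

end

locale sym_brace =
  fixes A :: "'a brace"
  assumes sym: "symmetric_skew_brace A"
begin

lemma skew: "skew_brace A"
  and skew_swap: "skew_brace \<lparr>dot = circ A, circ = dot A\<rparr>"
  using sym by (auto simp: symmetric_skew_brace_def)

sublocale C: group "circ A"
  using skew by (simp add: skew_brace_def)

text \<open>In the brace with the two operations exchanged, the action of \<open>a\<close> is the inverse of
  \<open>lam a\<close>. Its multiplicativity therefore says that \<open>lam\<close> reverses products.\<close>

lemma brace_lambda_dot:
  assumes "a \<in> carrier (dot A)" "b \<in> carrier (dot A)" "c \<in> carrier (dot A)"
  shows "brace_lambda A (a \<otimes>\<^bsub>dot A\<^esub> b) c = brace_lambda A b (brace_lambda A a c)"
proof -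
  interpret D: group "dot A" using skew by (simp add: skew_brace_def)
  let ?B = "\<lparr>dot = circ A, circ = dot A\<rparr>"
  note car = skew_brace_carrier[OF skew]
  note closed = brace_lambda_closed[OF skew]
  have inv1: "brace_lambda ?B x (brace_lambda A x y) = y"
    if "x \<in> carrier (dot A)" "y \<in> carrier (dot A)" for x y
    using that circ_eq_lambda[OF skew, of x y]
    by (simp add: brace_lambda_def[of ?B] C.mult_inv_cancel car flip: circ_eq_lambda[OF skew])
  have inv2: "brace_lambda A x (brace_lambda ?B x y) = y"
    if "x \<in> carrier (dot A)" "y \<in> carrier (dot A)" for x y
  proof -
    have "x \<otimes>\<^bsub>circ A\<^esub> brace_lambda ?B x y = x \<otimes>\<^bsub>dot A\<^esub> y"
      using that circ_eq_lambda[OF skew_swap, of x y] by (simp add: car)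
    then show ?thesis
      using that by (simp add: brace_lambda_def[of A] D.mult_inv_cancel)
  qed
  let ?y = "brace_lambda A b (brace_lambda A a c)"
  have "brace_lambda ?B (a \<otimes>\<^bsub>dot A\<^esub> b) ?y = brace_lambda ?B a (brace_lambda ?B b ?y)"
    using brace_lambda_circ[OF skew_swap, of a b ?y] assms by (simp add: car closed)
  also have "\<dots> = c" using assms by (simp add: inv1 closed)
  finally show ?thesis
    using inv2[of "a \<otimes>\<^bsub>dot A\<^esub> b" ?y] assms by (simp add: closed)
qed

sublocale L: lambda_group "dot A" "brace_lambda A"
  rewrites star_eq: "lambda_group.star (dot A) (brace_lambda A) = brace_star A"
proof -
  interpret D: group "dot A" using skew by (simp add: skew_brace_def)
  show lg: "lambda_group (dot A) (brace_lambda A)"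
    by unfold_locales
      (use circ_eq_lambda[OF skew] brace_lambda_circ[OF skew] in
        \<open>simp_all add: brace_lambda_closed[OF skew] brace_lambda_mult[OF skew]
          brace_lambda_one[OF skew] brace_lambda_dot\<close>)
  show "lambda_group.star (dot A) (brace_lambda A) = brace_star A"
    by (intro ext) (simp add: brace_star_def lambda_group.star_def[OF lg])
qed

lemma carrier_circ [simp]: "carrier (circ A) = carrier (dot A)"
  by (rule skew_brace_carrier[OF skew])

lemmas circ_eq = circ_eq_lambda[OF skew]

lemma one_circ: "\<one>\<^bsub>circ A\<^esub> = \<one>\<^bsub>dot A\<^esub>"
  by (rule skew_brace_one_eq[OF skew])

lemma inv_circ:
  assumes "a \<in> carrier (dot A)"
  shows "inv\<^bsub>circ A\<^esub> a = brace_lambda A (inv\<^bsub>dot A\<^esub> a) (inv\<^bsub>dot A\<^esub> a)"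
proof (rule C.inv_unique'[symmetric])
  have "brace_lambda A (inv\<^bsub>dot A\<^esub> a) (inv\<^bsub>dot A\<^esub> a) \<in> carrier (circ A)"
    using assms by simp
  moreover show r: "a \<otimes>\<^bsub>circ A\<^esub> brace_lambda A (inv\<^bsub>dot A\<^esub> a) (inv\<^bsub>dot A\<^esub> a) = \<one>\<^bsub>circ A\<^esub>"
    using assms by (simp add: circ_eq one_circ)
  ultimately show "brace_lambda A (inv\<^bsub>dot A\<^esub> a) (inv\<^bsub>dot A\<^esub> a) \<otimes>\<^bsub>circ A\<^esub> a = \<one>\<^bsub>circ A\<^esub>"
    using assms C.r_inv_ex C.inv_comm by simp
qed (use assms in simp_all)

lemma lam_inv_circ:
  assumes "a \<in> carrier (dot A)"
  shows "brace_lambda A a (inv\<^bsub>circ A\<^esub> a) = inv\<^bsub>dot A\<^esub> a"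
  using assms by (simp add: inv_circ)

lemma annihilator_eq_center: "annihilator A = L.center"
  by (auto simp: annihilator_def L.center_def L.commutes_iff)

end

definition brace_hom :: "'a brace \<Rightarrow> 'b brace \<Rightarrow> ('a \<Rightarrow> 'b) set" where
  "brace_hom A B = hom (dot A) (dot B) \<inter> hom (circ A) (circ B)"

locale sym_brace_hom = A: sym_brace A + B: sym_brace B
  for A :: "'a brace" and B :: "'b brace" and f +
  assumes f: "f \<in> brace_hom A B"
begin

sublocale dot: group_hom "dot A" "dot B" f
  by unfold_locales (use f in \<open>simp add: brace_hom_def\<close>)

sublocale circ: group_hom "circ A" "circ B" f
  by unfold_locales (use f in \<open>simp add: brace_hom_def\<close>)

lemma hom_lambda:
  "a \<in> carrier (dot A) \<Longrightarrow> b \<in> carrier (dot A) \<Longrightarrow>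
    f (brace_lambda A a b) = brace_lambda B (f a) (f b)"
  using circ.hom_mult[of a b] A.C.m_closed[of a b] by (simp add: brace_lambda_def)

lemma hom_star:
  "a \<in> carrier (dot A) \<Longrightarrow> b \<in> carrier (dot A) \<Longrightarrow>
    f (brace_star A a b) = brace_star B (f a) (f b)"
  by (simp add: brace_star_def hom_lambda)

lemma hom_symbol_value:
  "a \<in> carrier (dot A) \<Longrightarrow> b \<in> carrier (dot A) \<Longrightarrow>
    f (symbol_value A e a b) = symbol_value B e (f a) (f b)"
  by (cases e) (simp_all add: hom_star dot.hom_commutator)

end

lemma (in sym_brace) symbol_value_closed [simp]:
  "a \<in> carrier (dot A) \<Longrightarrow> b \<in> carrier (dot A) \<Longrightarrow> symbol_value A e a b \<in> carrier (dot A)"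
  by (cases e) simp_all

lemma (in sym_brace) word_value_closed:
  "length as = length m + 1 \<Longrightarrow> set as \<subseteq> carrier (dot A) \<Longrightarrow>
    word_value A m as \<in> carrier (dot A)"
proof (induction m arbitrary: as)
  case Nil
  then show ?case by (cases as) auto
next
  case (Cons e m)
  then show ?case by (cases as) auto
qed

lemma (in sym_brace_hom) hom_word_value:
  "length as = length m + 1 \<Longrightarrow> set as \<subseteq> carrier (dot A) \<Longrightarrow>
    f (word_value A m as) = word_value B m (map f as)"
proof (induction m arbitrary: as)
  case Nil
  then show ?case by (cases as) auto
next
  case (Cons e m)
  then show ?case by (cases as) (auto simp: hom_symbol_value A.word_value_closed)
qed

section \<open>Ideals and quotients\<close>

text \<open>Normality for \<open>\<circ>\<close> is replaced by closure under \<open>x * a\<close>, which is easier to check for the ideals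
below because their elements are described through \<open>*\<close>; \<open>ideal_circ_normal\<close> recovers it.\<close>

definition brace_ideal :: "'a brace \<Rightarrow> 'a set \<Rightarrow> bool" where
  "brace_ideal A I \<longleftrightarrow> I \<lhd> dot A \<and>
     (\<forall>a \<in> carrier (dot A). \<forall>x \<in> I. brace_lambda A a x \<in> I \<and> brace_star A x a \<in> I)"

context sym_brace
begin

context
  fixes I assumes I: "brace_ideal A I"
begin

interpretation I: normal I "dot A"
  using I by (simp add: brace_ideal_def)

lemma ideal_lambda: "a \<in> carrier (dot A) \<Longrightarrow> x \<in> I \<Longrightarrow> brace_lambda A a x \<in> I"
  and ideal_star: "a \<in> carrier (dot A) \<Longrightarrow> x \<in> I \<Longrightarrow> brace_star A x a \<in> I"
  using I by (auto simp: brace_ideal_def)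

text \<open>Multiplying by \<open>n\<close> through \<open>\<cdot>\<close> moves \<open>a\<close> only inside its coset for \<open>\<circ>\<close>. With \<open>b\<close> the inverse
of \<open>a\<close> for \<open>\<circ>\<close> and \<open>k = n * b\<close>, the element equals \<open>n \<cdot> a\<lambda>\<^sub>a(k)a\<^sup>-\<^sup>1\<close>. This yields both the normality of
the ideal for \<open>\<circ>\<close> and the equality of its cosets in the two groups.\<close>

lemma ideal_dot_circ_inv:
  assumes n: "n \<in> I" and a: "a \<in> carrier (dot A)"
  shows "(n \<otimes>\<^bsub>dot A\<^esub> a) \<otimes>\<^bsub>circ A\<^esub> inv\<^bsub>circ A\<^esub> a \<in> I"
proof -
  let ?b = "inv\<^bsub>circ A\<^esub> a"
  have b: "?b \<in> carrier (dot A)" using C.inv_closed[of a] a by simp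
  define k where "k = brace_star A n ?b"
  have nc: "n \<in> carrier (dot A)" using n by simp
  have k: "k \<in> I" using ideal_star[OF b n] by (simp add: k_def)
  have kc: "k \<in> carrier (dot A)" using k by simp
  have "brace_lambda A (n \<otimes>\<^bsub>dot A\<^esub> a) ?b = brace_lambda A a (k \<otimes>\<^bsub>dot A\<^esub> ?b)"
    using nc a b by (simp add: L.lam_of_mult k_def L.lam_eq_star_mult[of n])
  also have "\<dots> = brace_lambda A a k \<otimes>\<^bsub>dot A\<^esub> inv\<^bsub>dot A\<^esub> a"
    using kc a b by (simp add: L.lam_mult lam_inv_circ)
  finally have "(n \<otimes>\<^bsub>dot A\<^esub> a) \<otimes>\<^bsub>circ A\<^esub> ?b =
      n \<otimes>\<^bsub>dot A\<^esub> (a \<otimes>\<^bsub>dot A\<^esub> brace_lambda A a k \<otimes>\<^bsub>dot A\<^esub> inv\<^bsub>dot A\<^esub> a)"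
    using nc kc a b by (simp add: circ_eq L.m_assoc)
  then show ?thesis
    using n a I.inv_op_closed2[OF a ideal_lambda[OF a k]] by simp
qed

lemma ideal_circ_normal: "I \<lhd> circ A"
proof (rule C.normal_invI)
  show "subgroup I (circ A)"
  proof (rule C.subgroupI)
    show "I \<noteq> {}" using I.one_closed by blast
    show "inv\<^bsub>circ A\<^esub> x \<in> I" if "x \<in> I" for x
      using that by (simp add: inv_circ ideal_lambda)
    show "x \<otimes>\<^bsub>circ A\<^esub> y \<in> I" if "x \<in> I" "y \<in> I" for x y
      using that by (simp add: circ_eq ideal_lambda)
  qed (use I.subset in simp)
  fix a n assume "a \<in> carrier (circ A)" and n: "n \<in> I"
  then have a: "a \<in> carrier (dot A)" by simp
  let ?n = "a \<otimes>\<^bsub>dot A\<^esub> brace_lambda A a n \<otimes>\<^bsub>dot A\<^esub> inv\<^bsub>dot A\<^esub> a"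
  have "a \<otimes>\<^bsub>circ A\<^esub> n = ?n \<otimes>\<^bsub>dot A\<^esub> a"
    using a n by (simp add: circ_eq L.group_normalize)
  then show "a \<otimes>\<^bsub>circ A\<^esub> n \<otimes>\<^bsub>circ A\<^esub> inv\<^bsub>circ A\<^esub> a \<in> I"
    using ideal_dot_circ_inv[OF I.inv_op_closed2[OF a ideal_lambda[OF a n]] a] by simp
qed

lemma ideal_cosets_eq:
  assumes a: "a \<in> carrier (dot A)"
  shows "I #>\<^bsub>circ A\<^esub> a = I #>\<^bsub>dot A\<^esub> a"
proof
  show "I #>\<^bsub>circ A\<^esub> a \<subseteq> I #>\<^bsub>dot A\<^esub> a"
  proof
    fix x assume "x \<in> I #>\<^bsub>circ A\<^esub> a"
    then obtain n where n: "n \<in> I" "x = n \<otimes>\<^bsub>circ A\<^esub> a" by (auto simp: r_coset_def)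
    then have "x = (n \<otimes>\<^bsub>dot A\<^esub> brace_star A n a) \<otimes>\<^bsub>dot A\<^esub> a"
      using a by (simp add: circ_eq L.lam_eq_star_mult L.m_assoc)
    moreover have "n \<otimes>\<^bsub>dot A\<^esub> brace_star A n a \<in> I"
      using n a by (simp add: ideal_star)
    ultimately show "x \<in> I #>\<^bsub>dot A\<^esub> a" by (auto simp: r_coset_def)
  qed
  show "I #>\<^bsub>dot A\<^esub> a \<subseteq> I #>\<^bsub>circ A\<^esub> a"
  proof
    fix x assume "x \<in> I #>\<^bsub>dot A\<^esub> a"
    then obtain n where n: "n \<in> I" "x = n \<otimes>\<^bsub>dot A\<^esub> a" by (auto simp: r_coset_def)
    then have "x \<in> carrier (dot A)" using a by simp
    moreover have "x \<otimes>\<^bsub>circ A\<^esub> inv\<^bsub>circ A\<^esub> a \<in> I"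
      using ideal_dot_circ_inv[OF n(1) a] n(2) by simp
    ultimately show "x \<in> I #>\<^bsub>circ A\<^esub> a"
      using subgroup.rcos_module_rev[OF normal_imp_subgroup[OF ideal_circ_normal] C.is_group] a
      by simp
  qed
qed

lemma quot_hom: "(\<lambda>a. I #>\<^bsub>dot A\<^esub> a) \<in> brace_hom A (brace_quot A I)"
proof -
  have "(\<lambda>a. I #>\<^bsub>circ A\<^esub> a) \<in> hom (circ A) (circ A Mod I)"
    by (rule normal.r_coset_hom_Mod[OF ideal_circ_normal])
  then have "(\<lambda>a. I #>\<^bsub>dot A\<^esub> a) \<in> hom (circ A) (circ A Mod I)"
    using C.m_closed by (auto simp: hom_def Pi_def ideal_cosets_eq)
  then show ?thesis
    using I.r_coset_hom_Mod by (simp add: brace_hom_def brace_quot_def)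
qed

lemma carrier_quot: "carrier (dot (brace_quot A I)) = (\<lambda>a. I #>\<^bsub>dot A\<^esub> a) ` carrier (dot A)"
  by (simp add: brace_quot_def carrier_FactGroup)

lemma carrier_circ_quot: "carrier (circ (brace_quot A I)) = carrier (dot (brace_quot A I))"
  by (auto simp: brace_quot_def carrier_FactGroup ideal_cosets_eq)

lemma coset_eq_one_iff:
  "a \<in> carrier (dot A) \<Longrightarrow> I #>\<^bsub>dot A\<^esub> a = \<one>\<^bsub>dot (brace_quot A I)\<^esub> \<longleftrightarrow> a \<in> I"
  using L.coset_join1[of I a] L.coset_join2[of a I] I.subgroup_axioms by (auto simp: brace_quot_def)

end

end

text \<open>The brace law is an identity, so it passes to images. Applied to the coset map, also with the
  operations exchanged, it gives the quotient brace.\<close>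

lemma skew_brace_image:
  assumes A: "skew_brace A" and Q: "group (dot Q)" "group (circ Q)"
    and car: "carrier (circ Q) = carrier (dot Q)"
    and f: "f \<in> brace_hom A Q" and surj: "f ` carrier (dot A) = carrier (dot Q)"
  shows "skew_brace Q"
proof -
  interpret D: group_hom "dot A" "dot Q" f
    using A Q f by (simp add: group_hom_def group_hom_axioms_def skew_brace_def brace_hom_def)
  interpret C: group_hom "circ A" "circ Q" f
    using A Q f by (simp add: group_hom_def group_hom_axioms_def skew_brace_def brace_hom_def)
  have closed: "x \<otimes>\<^bsub>circ A\<^esub> y \<in> carrier (dot A)"
    if "x \<in> carrier (dot A)" "y \<in> carrier (dot A)" for x y
    using that by (rule skew_brace_circ_closed[OF A])
  have circ: "f x \<otimes>\<^bsub>circ Q\<^esub> f y = f (x \<otimes>\<^bsub>circ A\<^esub> y)"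
    if "x \<in> carrier (dot A)" "y \<in> carrier (dot A)" for x y
    using that skew_brace_carrier[OF A] by simp
  have "f a \<otimes>\<^bsub>circ Q\<^esub> (f b \<otimes>\<^bsub>dot Q\<^esub> f c) =
      (f a \<otimes>\<^bsub>circ Q\<^esub> f b) \<otimes>\<^bsub>dot Q\<^esub> inv\<^bsub>dot Q\<^esub> (f a) \<otimes>\<^bsub>dot Q\<^esub> (f a \<otimes>\<^bsub>circ Q\<^esub> f c)"
    if "a \<in> carrier (dot A)" "b \<in> carrier (dot A)" "c \<in> carrier (dot A)" for a b c
  proof -
    have "a \<otimes>\<^bsub>circ A\<^esub> (b \<otimes>\<^bsub>dot A\<^esub> c) =
        (a \<otimes>\<^bsub>circ A\<^esub> b) \<otimes>\<^bsub>dot A\<^esub> inv\<^bsub>dot A\<^esub> a \<otimes>\<^bsub>dot A\<^esub> (a \<otimes>\<^bsub>circ A\<^esub> c)"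
      using A that by (simp add: skew_brace_def)
    from arg_cong[OF this, of f] show ?thesis
      using that by (simp add: closed circ del: C.hom_mult flip: D.hom_mult D.hom_inv)
  qed
  then show ?thesis
    using Q car by (auto simp: skew_brace_def simp flip: surj)
qed

context sym_brace
begin

lemma quot_sym_brace:
  assumes I: "brace_ideal A I"
  shows "sym_brace (brace_quot A I)"
proof -
  let ?Q = "brace_quot A I"
  let ?f = "\<lambda>a. I #>\<^bsub>dot A\<^esub> a"
  have groups: "group (dot ?Q)" "group (circ ?Q)"
    using I ideal_circ_normal[OF I]
    by (auto simp: brace_quot_def brace_ideal_def normal.factorgroup_is_group)
  have surj: "?f ` carrier (dot A) = carrier (dot ?Q)"
    by (simp add: carrier_quot[OF I])
  have "skew_brace ?Q"
    by (rule skew_brace_image[OF skew groups carrier_circ_quot[OF I] quot_hom[OF I] surj])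
  moreover have "skew_brace \<lparr>dot = circ ?Q, circ = dot ?Q\<rparr>"
    by (rule skew_brace_image[OF skew_swap, where f = ?f])
      (use groups carrier_circ_quot[OF I] quot_hom[OF I] surj in \<open>auto simp: brace_hom_def\<close>)
  ultimately show ?thesis
    by (simp add: sym_brace_def symmetric_skew_brace_def)
qed

lemma quot_sym_brace_hom:
  assumes "brace_ideal A I"
  shows "sym_brace_hom A (brace_quot A I) (\<lambda>a. I #>\<^bsub>dot A\<^esub> a)"
  using assms quot_sym_brace quot_hom sym_brace_axioms
  by (simp add: sym_brace_hom_def sym_brace_hom_axioms_def)

end

section \<open>The annihilator series and commutator words\<close>

declare annihilator_series.simps(2) [simp del]

context sym_brace
begin

lemma ideal_normal: "brace_ideal A I \<Longrightarrow> I \<lhd> dot A"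
  by (simp add: brace_ideal_def)

lemma annihilator_series_step:
  assumes I: "brace_ideal A (annihilator_series A n)"
  shows "a \<in> annihilator_series A (Suc n) \<longleftrightarrow> a \<in> carrier (dot A) \<and>
    (\<forall>b \<in> carrier (dot A). brace_star A a b \<in> annihilator_series A n \<and>
      brace_star A b a \<in> annihilator_series A n \<and>
      commutator (dot A) a b \<in> annihilator_series A n)"
proof -
  interpret Q: sym_brace_hom A "brace_quot A (annihilator_series A n)"
    "\<lambda>a. annihilator_series A n #>\<^bsub>dot A\<^esub> a"
    by (rule quot_sym_brace_hom[OF I])
  show ?thesis
    by (auto simp: annihilator_series.simps(2) annihilator_def carrier_quot[OF I] coset_eq_one_iff[OF I, symmetric]
        Q.hom_star Q.dot.hom_commutator)
qed

lemma annihilator_series_ideal: "brace_ideal A (annihilator_series A n)"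
proof (induction n)
  case 0
  show ?case
    using L.one_is_normal by (auto simp: brace_ideal_def L.star_eq_one_iff)
next
  case (Suc n)
  let ?I = "annihilator_series A n" and ?J = "annihilator_series A (Suc n)"
  interpret Q: sym_brace_hom A "brace_quot A ?I" "\<lambda>a. ?I #>\<^bsub>dot A\<^esub> a"
    by (rule quot_sym_brace_hom[OF Suc])
  have J: "?J = {a \<in> carrier (dot A). ?I #>\<^bsub>dot A\<^esub> a \<in> Q.B.L.center}"
    by (simp add: annihilator_series.simps(2) Q.B.annihilator_eq_center)
  have "?J \<lhd> dot A"
    unfolding J by (rule Q.dot.normal_preimage[OF Q.B.L.center_normal])
  moreover have "?I \<subseteq> ?J"
  proof
    fix x assume x: "x \<in> ?I"
    then have xc: "x \<in> carrier (dot A)"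
      using subgroup.mem_carrier[OF normal_imp_subgroup[OF ideal_normal[OF Suc]]] by blast
    then have "?I #>\<^bsub>dot A\<^esub> x = \<one>\<^bsub>dot (brace_quot A ?I)\<^esub>"
      using x coset_eq_one_iff[OF Suc] by blast
    then show "x \<in> ?J"
      using xc subgroup.one_closed[OF normal_imp_subgroup[OF Q.B.L.center_normal]]
      by (simp add: J)
  qed
  moreover have "brace_lambda A a x \<in> ?J" if "a \<in> carrier (dot A)" "x \<in> ?J" for a x
  proof -
    have x: "x \<in> carrier (dot A)" "?I #>\<^bsub>dot A\<^esub> x \<in> Q.B.L.center"
      using that(2) unfolding J by auto
    then have "?I #>\<^bsub>dot A\<^esub> (brace_lambda A a x) = ?I #>\<^bsub>dot A\<^esub> x"
      using that(1) by (simp add: Q.hom_lambda Q.B.L.center_def Q.B.L.commutes_def)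
    then show ?thesis unfolding J using that x by simp
  qed
  moreover have "brace_star A x a \<in> ?I" if "a \<in> carrier (dot A)" "x \<in> ?J" for a x
    using that annihilator_series_step[OF Suc] by blast
  ultimately show ?case
    unfolding brace_ideal_def by blast
qed

lemmas annihilator_series_Suc_iff = annihilator_series_step[OF annihilator_series_ideal]

lemma annihilator_series_carrier: "annihilator_series A n \<subseteq> carrier (dot A)"
  using subgroup.subset[OF normal_imp_subgroup[OF ideal_normal[OF annihilator_series_ideal]]] .

text \<open>The analogue of \<open>[Z\<^sub>n, \<gamma>\<^sub>k] \<le> Z\<^sub>n\<^sub>-\<^sub>k\<close>: each letter of the word costs one step of the annihilator
series. The index \<open>i\<close> is kept general because the induction uses the hypothesis twice, for \<open>i\<close>
(commutation with \<open>U\<close>) and for \<open>i + 1\<close> (central defects modulo the \<open>i\<close>-th term).\<close>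

lemma word_value_commutes:
  assumes "length as = length m + 1" "set as \<subseteq> carrier (dot A)"
    and "z \<in> annihilator_series A (i + length m + 1)"
  shows "commutator (dot A) z (word_value A m as) \<in> annihilator_series A i \<and>
    brace_star A z (word_value A m as) \<in> annihilator_series A i \<and>
    brace_star A (word_value A m as) z \<in> annihilator_series A i"
  using assms
proof (induction m arbitrary: as i z)
  case Nil
  then show ?case
    using annihilator_series_Suc_iff[of z i] by (cases as) auto
next
  case (Cons e m)
  then obtain g bs where as: "as = g # bs" by (cases as) auto
  let ?k = "length m"
  let ?U = "annihilator_series A (Suc (i + ?k))" and ?Z = "annihilator_series A (Suc (Suc (i + ?k)))"
  let ?I = "annihilator_series A i"
  let ?p = "\<lambda>a. ?I #>\<^bsub>dot A\<^esub> a"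
  define y where "y = word_value A m bs"
  define c where "c = symbol_value A e g y"
  have bs: "length bs = length m + 1" "set bs \<subseteq> carrier (dot A)" and g: "g \<in> carrier (dot A)"
    using Cons.prems as by auto
  have y: "y \<in> carrier (dot A)" using bs by (simp add: y_def word_value_closed)
  have c: "c \<in> carrier (dot A)" using g y by (simp add: c_def)
  note I = annihilator_series_ideal[of i]
  interpret Q: sym_brace_hom A "brace_quot A ?I" ?p
    by (rule quot_sym_brace_hom[OF I])
  have surj: "?p ` carrier (dot A) = carrier (dot (brace_quot A ?I))"
    by (rule carrier_quot[OF I, symmetric])
  have Uc: "?U \<subseteq> carrier (dot A)" and Zc: "?Z \<subseteq> carrier (dot A)"
    by (rule annihilator_series_carrier)+
  have U_normal: "?p ` ?U \<lhd> dot (brace_quot A ?I)"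
    by (rule normal.surj_hom_normal_subgroup[OF ideal_normal[OF annihilator_series_ideal]
          Q.dot.group_hom_axioms surj])
  have Z_lam: "brace_lambda A x w \<in> ?Z" if "w \<in> ?Z" "x \<in> carrier (dot A)" for w x
    by (rule ideal_lambda[OF annihilator_series_ideal that(2,1)])
  have Uy: "Q.B.L.commutes (?p u) (?p y)" if u: "u \<in> ?U" for u
  proof -
    have "commutator (dot A) u y \<in> ?I \<and> brace_star A u y \<in> ?I \<and> brace_star A y u \<in> ?I"
      using Cons.IH[OF bs, of u i] u by (simp add: y_def)
    then show ?thesis
      using u Uc y coset_eq_one_iff[OF I] subsetD[OF Uc u]
      by (simp add: Q.B.L.commutes_iff flip: Q.hom_star Q.dot.hom_commutator)
  qed
  have center: "?p v \<in> Q.B.L.center" if "v \<in> annihilator_series A (Suc i)" for v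
    using that by (simp add: annihilator_series.simps(2) Q.B.annihilator_eq_center)
  have Zy: "?p (commutator (dot A) w y) \<in> Q.B.L.center \<and> ?p (brace_star A w y) \<in> Q.B.L.center \<and>
      ?p (brace_star A y w) \<in> Q.B.L.center" if w: "w \<in> ?Z" for w
    using Cons.IH[OF bs, of w "Suc i"] w center by (simp add: y_def)
  have z: "z \<in> ?Z" using Cons.prems by simp
  have zc: "z \<in> carrier (dot A)" using z Zc by blast
  let ?Q = "brace_quot A ?I"
  have sub: "?p ` ?U \<subseteq> carrier (dot ?Q)" "?p ` ?Z \<subseteq> carrier (dot ?Q)"
    using surj Uc Zc by blast+
  have ZU: "commutator (dot ?Q) z' x \<in> ?p ` ?U \<and>
      brace_star ?Q z' x \<in> ?p ` ?U \<and> brace_star ?Q x z' \<in> ?p ` ?U"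
    if "z' \<in> ?p ` ?Z" "x \<in> carrier (dot ?Q)" for z' x
  proof -
    obtain w b where w: "w \<in> ?Z" "z' = ?p w" and b: "b \<in> carrier (dot A)" "x = ?p b"
      using \<open>z' \<in> _\<close> \<open>x \<in> _\<close> unfolding surj[symmetric] by blast
    have "brace_star A w b \<in> ?U" "brace_star A b w \<in> ?U" "commutator (dot A) w b \<in> ?U"
      using w(1) b(1) annihilator_series_Suc_iff[of w "Suc (i + ?k)"] by simp_all
    moreover have "w \<in> carrier (dot A)" using w Zc by blast
    ultimately show ?thesis
      unfolding w(2) b(2) using b(1)
      by (metis Q.hom_star Q.dot.hom_commutator imageI)
  qed
  have Z_lam': "brace_lambda ?Q x z' \<in> ?p ` ?Z"
    if "z' \<in> ?p ` ?Z" "x \<in> carrier (dot ?Q)" for z' x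
  proof -
    obtain w b where w: "w \<in> ?Z" "z' = ?p w" and b: "b \<in> carrier (dot A)" "x = ?p b"
      using \<open>z' \<in> _\<close> \<open>x \<in> _\<close> unfolding surj[symmetric] by blast
    moreover have "w \<in> carrier (dot A)" using w Zc by blast
    ultimately show ?thesis
      using Z_lam[OF w(1) b(1)] by (metis Q.hom_lambda imageI)
  qed
  have Zy': "commutator (dot ?Q) z' (?p y) \<in> Q.B.L.center \<and>
      brace_star ?Q z' (?p y) \<in> Q.B.L.center \<and> brace_star ?Q (?p y) z' \<in> Q.B.L.center"
    if "z' \<in> ?p ` ?Z" for z'
  proof -
    obtain w where w: "w \<in> ?Z" "z' = ?p w" using \<open>z' \<in> _\<close> by blast
    moreover have "w \<in> carrier (dot A)" using w Zc by blast
    ultimately show ?thesis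
      using Zy[OF w(1)] y by (simp add: Q.hom_star Q.dot.hom_commutator)
  qed
  have Uy': "Q.B.L.commutes u (?p y)" if "u \<in> ?p ` ?U" for u
    using that Uy by blast
  note step = Q.B.L.commutes_step[OF sub Q.dot.hom_closed[OF g] Q.dot.hom_closed[OF y]
      Q.B.L.normal_invE(2)[OF U_normal] Z_lam' ZU Uy' Zy' imageI[OF z]]
  have "Q.B.L.commutes (?p z) (?p c)"
    using step g y by (cases e) (simp_all add: c_def Q.hom_star Q.dot.hom_commutator)
  then have "commutator (dot A) z c \<in> ?I \<and> brace_star A z c \<in> ?I \<and> brace_star A c z \<in> ?I"
    using zc c coset_eq_one_iff[OF I]
    by (simp add: Q.B.L.commutes_iff flip: Q.hom_star Q.dot.hom_commutator)
  then show ?case by (simp add: as c_def y_def)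
qed

lemma symbol_value_coset_absorb:
  assumes N: "N \<lhd> dot A" and comm: "\<And>u. u \<in> N \<Longrightarrow> L.commutes u y"
    and "g \<in> carrier (dot A)" "g' \<in> carrier (dot A)" "y \<in> carrier (dot A)"
    and "g' \<otimes>\<^bsub>dot A\<^esub> inv\<^bsub>dot A\<^esub> g \<in> N"
  shows "symbol_value A e g' y = symbol_value A e g y" "symbol_value A e y g' = symbol_value A e y g"
  using L.coset_absorb[OF assms] by (cases e; simp)+

text \<open>Modulo the \<open>i\<close>-th term of the series, the inner values differ by a central element, by the induction
hypothesis for \<open>i + 1\<close>, and the first arguments differ by an element commuting with the inner value,
by \<open>word_value_commutes\<close>. Either difference is absorbed. For \<open>i = 0\<close> this is equality of values.\<close>

lemma word_value_cong:
  assumes "length as = length m + 1" "set as \<subseteq> carrier (dot A)" "set bs \<subseteq> carrier (dot A)"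
    and "list_all2 (\<lambda>a b. annihilator_series A (i + length m) #>\<^bsub>dot A\<^esub> a =
      annihilator_series A (i + length m) #>\<^bsub>dot A\<^esub> b) as bs"
  shows "annihilator_series A i #>\<^bsub>dot A\<^esub> word_value A m as =
    annihilator_series A i #>\<^bsub>dot A\<^esub> word_value A m bs"
  using assms
proof (induction m arbitrary: as bs i)
  case Nil
  then show ?case by (cases as; cases bs) auto
next
  case (Cons e m)
  then obtain g as' g' bs' where as: "as = g # as'" and bs: "bs = g' # bs'"
    by (cases as; cases bs) auto
  let ?I = "annihilator_series A i" and ?J = "annihilator_series A (i + length (e # m))"
  let ?p = "\<lambda>a. ?I #>\<^bsub>dot A\<^esub> a"
  define y where "y = word_value A m as'"
  define y' where "y' = word_value A m bs'"
  have as': "length as' = length m + 1" "set as' \<subseteq> carrier (dot A)" and g: "g \<in> carrier (dot A)"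
    and bs': "length bs' = length m + 1" "set bs' \<subseteq> carrier (dot A)" and g': "g' \<in> carrier (dot A)"
    using Cons.prems as bs list_all2_lengthD[OF Cons.prems(4)] by auto
  have y: "y \<in> carrier (dot A)" "y' \<in> carrier (dot A)"
    using as' bs' by (simp_all add: y_def y'_def word_value_closed)
  note I = annihilator_series_ideal[of i]
  interpret Q: sym_brace_hom A "brace_quot A ?I" ?p
    by (rule quot_sym_brace_hom[OF I])
  have surj: "?p ` carrier (dot A) = carrier (dot (brace_quot A ?I))"
    by (rule carrier_quot[OF I, symmetric])
  have sub: "subgroup (annihilator_series A k) (dot A)" for k
    using normal_imp_subgroup[OF ideal_normal[OF annihilator_series_ideal]] .
  have J_normal: "?p ` ?J \<lhd> dot (brace_quot A ?I)"
    by (rule normal.surj_hom_normal_subgroup[OF ideal_normal[OF annihilator_series_ideal]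
          Q.dot.group_hom_axioms surj])
  have "?J #>\<^bsub>dot A\<^esub> g' = ?J #>\<^bsub>dot A\<^esub> g"
    using Cons.prems(4) by (simp add: as bs)
  then have "g' \<otimes>\<^bsub>dot A\<^esub> inv\<^bsub>dot A\<^esub> g \<in> ?J"
    using L.coset_eq_iff[OF sub g' g] by blast
  then have gJ: "?p g' \<otimes>\<^bsub>dot (brace_quot A ?I)\<^esub> inv\<^bsub>dot (brace_quot A ?I)\<^esub> ?p g \<in> ?p ` ?J"
    using g g' by (simp flip: Q.dot.hom_inv Q.dot.hom_mult)
  have J_comm: "Q.B.L.commutes u (?p y)" if u: "u \<in> ?p ` ?J" for u
  proof -
    obtain w where w: "w \<in> ?J" "u = ?p w" using u by blast
    then have wc: "w \<in> carrier (dot A)" using annihilator_series_carrier by blast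
    have "commutator (dot A) w y \<in> ?I \<and> brace_star A w y \<in> ?I \<and> brace_star A y w \<in> ?I"
      using word_value_commutes[OF as', of w i] w by (simp add: y_def)
    then show ?thesis
      using wc y w coset_eq_one_iff[OF I]
      by (simp add: Q.B.L.commutes_iff flip: Q.hom_star Q.dot.hom_commutator)
  qed
  have "list_all2 (\<lambda>a b. annihilator_series A (Suc i + length m) #>\<^bsub>dot A\<^esub> a =
      annihilator_series A (Suc i + length m) #>\<^bsub>dot A\<^esub> b) as' bs'"
    using Cons.prems(4) by (simp add: as bs)
  then have "annihilator_series A (Suc i) #>\<^bsub>dot A\<^esub> y' = annihilator_series A (Suc i) #>\<^bsub>dot A\<^esub> y"
    using Cons.IH[OF as' bs'(2), of "Suc i"] by (simp only: y_def y'_def)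
  then have "y' \<otimes>\<^bsub>dot A\<^esub> inv\<^bsub>dot A\<^esub> y \<in> annihilator_series A (Suc i)"
    using y L.coset_eq_iff[OF sub] by blast
  then have yc: "?p y' \<otimes>\<^bsub>dot (brace_quot A ?I)\<^esub> inv\<^bsub>dot (brace_quot A ?I)\<^esub> ?p y \<in> Q.B.L.center"
    using y
    by (simp add: annihilator_series.simps(2) Q.B.annihilator_eq_center
        flip: Q.dot.hom_inv Q.dot.hom_mult)
  have "?p (symbol_value A e g' y') = symbol_value (brace_quot A ?I) e (?p g') (?p y')"
    using g' y by (simp add: Q.hom_symbol_value)
  also have "\<dots> = symbol_value (brace_quot A ?I) e (?p g') (?p y)"
    by (rule Q.B.symbol_value_coset_absorb(2)[OF Q.B.L.center_normal])
      (use g' y yc in \<open>auto simp: Q.B.L.center_def\<close>)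
  also have "\<dots> = symbol_value (brace_quot A ?I) e (?p g) (?p y)"
    by (rule Q.B.symbol_value_coset_absorb(1)[OF J_normal J_comm]) (use g g' y gJ in auto)
  also have "\<dots> = ?p (symbol_value A e g y)"
    using g y by (simp add: Q.hom_symbol_value)
  finally show ?case
    by (simp add: as bs y_def y'_def)
qed

text \<open>The case \<open>i = 0\<close> of the congruence is the well-definedness of \<open>\<phi>\<^sub>m\<close>.\<close>

lemma word_map_eq:
  assumes "length as = length m + 1" "set as \<subseteq> carrier (dot A)"
  shows "word_map A m (map (\<lambda>a. annihilator_series A (length m) #>\<^bsub>dot A\<^esub> a) as) = word_value A m as"
  unfolding word_map_def
proof (rule the_equality)
  show "\<exists>bs. set bs \<subseteq> carrier (dot A) \<and>
      map (\<lambda>a. annihilator_series A (length m) #>\<^bsub>dot A\<^esub> a) as =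
      map (\<lambda>a. annihilator_series A (length m) #>\<^bsub>dot A\<^esub> a) bs \<and>
      word_value A m as = word_value A m bs"
    using assms by blast
  fix y
  assume "\<exists>bs. set bs \<subseteq> carrier (dot A) \<and>
      map (\<lambda>a. annihilator_series A (length m) #>\<^bsub>dot A\<^esub> a) as =
      map (\<lambda>a. annihilator_series A (length m) #>\<^bsub>dot A\<^esub> a) bs \<and> y = word_value A m bs"
  then obtain bs where bs: "set bs \<subseteq> carrier (dot A)" "y = word_value A m bs"
    and eq: "map (\<lambda>a. annihilator_series A (length m) #>\<^bsub>dot A\<^esub> a) as =
      map (\<lambda>a. annihilator_series A (length m) #>\<^bsub>dot A\<^esub> a) bs" by blast
  have "list_all2 (\<lambda>a b. annihilator_series A (0 + length m) #>\<^bsub>dot A\<^esub> a =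
      annihilator_series A (0 + length m) #>\<^bsub>dot A\<^esub> b) as bs"
    using eq by (simp add: list_all2_conv_all_nth map_equality_iff)
  from word_value_cong[OF assms bs(1) this]
  have "{\<one>\<^bsub>dot A\<^esub>} #>\<^bsub>dot A\<^esub> word_value A m as = {\<one>\<^bsub>dot A\<^esub>} #>\<^bsub>dot A\<^esub> word_value A m bs" by simp
  moreover have "length bs = length m + 1"
    using eq assms(1) by (metis length_map)
  ultimately show "y = word_value A m as"
    using word_value_closed[OF assms] word_value_closed[of bs m] bs by (simp add: r_coset_def)
qed

section \<open>The subgroups generated by long words\<close>

abbreviation word_values :: "nat \<Rightarrow> 'a set" where
  "word_values t \<equiv> {word_value A m as | m as. t \<le> length m \<and> length as = length m + 1 \<and>
     set as \<subseteq> carrier (dot A)}"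

lemma word_values_carrier: "word_values t \<subseteq> carrier (dot A)"
  by (auto intro: word_value_closed)

lemma word_subgroup_subgroup: "subgroup (word_subgroup A t) (dot A)"
  unfolding word_subgroup_def by (rule L.generate_is_subgroup[OF word_values_carrier])

lemma word_subgroup_carrier: "word_subgroup A t \<subseteq> carrier (dot A)"
  by (rule subgroup.subset[OF word_subgroup_subgroup])

lemma word_subgroup_Suc: "word_subgroup A (Suc t) \<subseteq> word_subgroup A t"
  unfolding word_subgroup_def by (rule L.mono_generate) (blast dest: Suc_leD)

lemma symbol_value_word_values:
  assumes "x \<in> carrier (dot A)" "w \<in> word_values t"
  shows "symbol_value A e x w \<in> word_subgroup A (Suc t)"
proof -
  obtain m as where "w = word_value A m as" "t \<le> length m" "length as = length m + 1"
    "set as \<subseteq> carrier (dot A)" using assms(2) by blast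
  then have "symbol_value A e x w \<in> word_values (Suc t)"
    using assms(1) by (intro CollectI exI[of _ "e # m"] exI[of _ "x # as"]) auto
  then show ?thesis
    unfolding word_subgroup_def by (rule generate.incl)
qed

text \<open>Reduces invariance of the subgroup of long words, under conjugation and under \<open>\<lambda>\<^sub>x\<close>, to its
  generators.\<close>

lemma hom_generate_subset:
  assumes h: "h \<in> hom (dot A) (dot A)" and S: "S \<subseteq> carrier (dot A)"
    and gen: "\<And>s. s \<in> S \<Longrightarrow> h s \<in> generate (dot A) S" and x: "x \<in> generate (dot A) S"
  shows "h x \<in> generate (dot A) S"
proof -
  interpret h: group_hom "dot A" "dot A" h by unfold_locales (rule h)
  have "h ` generate (dot A) S = generate (dot A) (h ` S)"
    by (rule h.generate_img[OF S, symmetric])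
  also have "\<dots> \<subseteq> generate (dot A) S"
    using gen by (intro L.generate_subgroup_incl L.generate_is_subgroup S) blast
  finally show ?thesis using x by blast
qed

text \<open>Since \<open>xsx\<^sup>-\<^sup>1 = [x,s]s\<close> and \<open>[x,s]\<close> is the value of a longer word, allowing all
  degrees at least \<open>t\<close> makes the subgroup invariant under conjugation; likewise \<open>\<lambda>\<^sub>x(s) = (x * s)s\<close>
  for the next lemma.\<close>

lemma word_subgroup_normal: "word_subgroup A t \<lhd> dot A"
proof (rule L.normal_invI[OF word_subgroup_subgroup])
  fix x w assume x: "x \<in> carrier (dot A)" and w: "w \<in> word_subgroup A t"
  let ?h = "\<lambda>w. x \<otimes>\<^bsub>dot A\<^esub> w \<otimes>\<^bsub>dot A\<^esub> inv\<^bsub>dot A\<^esub> x"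
  have "?h w \<in> generate (dot A) (word_values t)"
  proof (rule hom_generate_subset[OF _ word_values_carrier _ w[unfolded word_subgroup_def]])
    show "?h \<in> hom (dot A) (dot A)"
      using x by (auto simp: hom_def L.group_normalize)
    fix s assume s: "s \<in> word_values t"
    then have sc: "s \<in> carrier (dot A)" using word_values_carrier by blast
    have "commutator (dot A) x s \<in> word_subgroup A t"
      using symbol_value_word_values[OF x s, of Gamma] word_subgroup_Suc by auto
    moreover have "s \<in> word_subgroup A t"
      unfolding word_subgroup_def using s by (rule generate.incl)
    moreover have "?h s = commutator (dot A) x s \<otimes>\<^bsub>dot A\<^esub> s"
      using x sc by (simp add: commutator_def L.group_normalize)
    ultimately show "?h s \<in> generate (dot A) (word_values t)"
      using subgroup.m_closed[OF word_subgroup_subgroup] by (simp add: word_subgroup_def)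
  qed
  then show "?h w \<in> word_subgroup A t" by (simp add: word_subgroup_def)
qed

lemma word_subgroup_lambda:
  assumes x: "x \<in> carrier (dot A)" and w: "w \<in> word_subgroup A t"
  shows "brace_lambda A x w \<in> word_subgroup A t"
proof -
  have "brace_lambda A x w \<in> generate (dot A) (word_values t)"
  proof (rule hom_generate_subset[OF _ word_values_carrier _ w[unfolded word_subgroup_def]])
    show "brace_lambda A x \<in> hom (dot A) (dot A)"
      using x by (auto simp: hom_def L.lam_mult)
    fix s assume s: "s \<in> word_values t"
    then have sc: "s \<in> carrier (dot A)" using word_values_carrier by blast
    have "brace_star A x s \<in> word_subgroup A t"
      using symbol_value_word_values[OF x s, of Star] word_subgroup_Suc by auto
    moreover have "s \<in> word_subgroup A t"
      unfolding word_subgroup_def using s by (rule generate.incl)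
    ultimately show "brace_lambda A x s \<in> generate (dot A) (word_values t)"
      using subgroup.m_closed[OF word_subgroup_subgroup] x sc
      by (simp add: word_subgroup_def L.lam_eq_star_mult)
  qed
  then show ?thesis by (simp add: word_subgroup_def)
qed

lemma word_subgroup_step:
  assumes a: "a \<in> carrier (dot A)" and c: "c \<in> word_subgroup A t"
  shows "commutator (dot A) a c \<in> word_subgroup A (Suc t)"
    and "brace_star A a c \<in> word_subgroup A (Suc t) \<and> brace_star A c a \<in> word_subgroup A (Suc t)"
proof -
  note gen = symbol_value_word_values[OF a, of _ t]
  show "commutator (dot A) a c \<in> word_subgroup A (Suc t)"
    by (rule L.commutator_generate_normal[OF word_subgroup_normal word_values_carrier a _
          c[unfolded word_subgroup_def]])
      (use gen[of _ Gamma] in simp)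
  show "brace_star A a c \<in> word_subgroup A (Suc t) \<and> brace_star A c a \<in> word_subgroup A (Suc t)"
    by (rule L.star_generate_normal[OF word_subgroup_normal word_subgroup_lambda
          word_values_carrier a _ c[unfolded word_subgroup_def]])
      (use gen[of _ Star] gen[of _ Star_bar] in simp_all)
qed

lemma word_subgroup_ideal: "brace_ideal A (word_subgroup A t)"
  unfolding brace_ideal_def
  using word_subgroup_normal word_subgroup_lambda word_subgroup_step(2) word_subgroup_Suc by blast

text \<open>The key step for the group \<open>\<circ>\<close>. Modulo the next subgroup of long words, \<open>c\<close> lies in the
annihilator, and there \<open>a \<circ> c = ac = ca = c \<circ> a\<close>.\<close>

lemma circ_commutator_word_subgroup:
  assumes a: "a \<in> carrier (dot A)" and c: "c \<in> word_subgroup A t"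
  shows "commutator (circ A) a c \<in> word_subgroup A (Suc t)"
proof -
  let ?N = "word_subgroup A (Suc t)"
  let ?p = "\<lambda>a. ?N #>\<^bsub>dot A\<^esub> a"
  note N = word_subgroup_ideal[of "Suc t"]
  interpret Q: sym_brace_hom A "brace_quot A ?N" ?p
    by (rule quot_sym_brace_hom[OF N])
  have cc: "c \<in> carrier (dot A)" using c word_subgroup_carrier by blast
  have "Q.B.L.commutes (?p a) (?p c)"
    using a cc word_subgroup_step[OF a c] coset_eq_one_iff[OF N]
    by (simp add: Q.B.L.commutes_iff flip: Q.hom_star Q.dot.hom_commutator)
  then have "?p a \<otimes>\<^bsub>circ (brace_quot A ?N)\<^esub> ?p c = ?p c \<otimes>\<^bsub>circ (brace_quot A ?N)\<^esub> ?p a"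
    using a cc by (simp add: Q.B.circ_eq Q.B.L.commutes_def)
  then have "commutator (circ (brace_quot A ?N)) (?p a) (?p c) = \<one>\<^bsub>circ (brace_quot A ?N)\<^esub>"
    using a cc by (simp add: Q.B.C.commutator_eq_one_iff)
  then have "?p (commutator (circ A) a c) = \<one>\<^bsub>dot (brace_quot A ?N)\<^esub>"
    using a cc by (simp add: Q.circ.hom_commutator Q.B.one_circ)
  moreover have "commutator (circ A) a c \<in> carrier (dot A)"
    using C.commutator_closed[of a c] a cc by simp
  ultimately show ?thesis
    using coset_eq_one_iff[OF N] by blast
qed

lemma circ_iterated_commutator_word_subgroup:
  "length gs = Suc n \<Longrightarrow> set gs \<subseteq> carrier (dot A) \<Longrightarrow>
    iterated_commutator (circ A) gs \<in> word_subgroup A n"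
proof (induction n arbitrary: gs)
  case 0
  then obtain g where "gs = [g]" "g \<in> carrier (dot A)" by (auto simp: length_Suc_conv)
  then show ?case
    unfolding word_subgroup_def
    by (auto intro!: generate.incl exI[of _ "[] :: comm_word"] exI[of _ "[g]"])
next
  case (Suc n)
  then obtain g h hs where "gs = g # h # hs" by (auto simp: length_Suc_conv)
  then show ?case
    using Suc by (simp add: circ_commutator_word_subgroup)
qed

lemma word_value_Gamma:
  "length gs = Suc n \<Longrightarrow> word_value A (replicate n Gamma) gs = iterated_commutator (dot A) gs"
proof (induction n arbitrary: gs)
  case 0
  then show ?case by (auto simp: length_Suc_conv)
next
  case (Suc n)
  then obtain g h hs where "gs = g # h # hs" by (auto simp: length_Suc_conv)
  then show ?case using Suc by simp
qed

lemma dot_iterated_commutator_word_subgroup: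
  assumes "length gs = Suc n" "set gs \<subseteq> carrier (dot A)"
  shows "iterated_commutator (dot A) gs \<in> word_subgroup A n"
  unfolding word_subgroup_def
  using assms word_value_Gamma[OF assms(1)]
  by (intro generate.incl CollectI exI[of _ "replicate n Gamma"] exI[of _ gs]) simp

lemma word_subgroup_circ_subgroup: "subgroup (word_subgroup A t) (circ A)"
  by (rule normal_imp_subgroup[OF ideal_circ_normal[OF word_subgroup_ideal]])

end

section \<open>Upper central series and isoclinism of groups\<close>

text \<open>Regarding a group as a brace with equal operations turns the upper central series into the
annihilator series, since all values of \<open>*\<close> are trivial. The facts on annihilator series and words
then specialize to groups.\<close>

definition trivial_brace :: "'a monoid \<Rightarrow> 'a brace" where
  "trivial_brace G = \<lparr>dot = G, circ = G\<rparr>"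

lemma trivial_brace_sym_brace:
  fixes G :: "'a monoid"
  assumes "group G"
  shows "sym_brace (trivial_brace G)"
proof -
  interpret group G by fact
  show ?thesis
    by (simp add: sym_brace_def symmetric_skew_brace_def skew_brace_def trivial_brace_def
        is_group group_normalize)
qed

lemma trivial_brace_star:
  fixes G :: "'a monoid"
  assumes "group G" "a \<in> carrier G" "b \<in> carrier G"
  shows "brace_star (trivial_brace G) a b = \<one>\<^bsub>G\<^esub>"
  using assms
  by (simp add: brace_star_def brace_lambda_def trivial_brace_def group.mult_inv_cancel group.r_inv)

lemma annihilator_trivial_brace:
  fixes G :: "'a monoid"
  assumes "group G"
  shows "annihilator (trivial_brace G) = group_center G"
  using trivial_brace_star[OF assms] group.commutator_eq_one_iff[OF assms]
  by (auto simp: annihilator_def group_center_def trivial_brace_def)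

lemma upper_central_eq_annihilator_series:
  fixes G :: "'a monoid"
  assumes "group G"
  shows "upper_central G n = annihilator_series (trivial_brace G) n"
proof (induction n)
  case 0
  show ?case by (simp add: trivial_brace_def)
next
  case (Suc n)
  let ?N = "annihilator_series (trivial_brace G) n"
  interpret T: sym_brace "trivial_brace G"
    by (rule trivial_brace_sym_brace[OF assms])
  have "?N \<lhd> G"
    using T.ideal_normal[OF T.annihilator_series_ideal] by (simp add: trivial_brace_def)
  then have "annihilator (trivial_brace (G Mod ?N)) = group_center (G Mod ?N)"
    by (intro annihilator_trivial_brace normal.factorgroup_is_group)
  moreover have "brace_quot (trivial_brace G) ?N = trivial_brace (G Mod ?N)"
    by (simp add: brace_quot_def trivial_brace_def)
  ultimately show ?case
    using Suc by (simp add: annihilator_series.simps(2)) (simp add: trivial_brace_def)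
qed

lemma map_preimage_list:
  assumes "set ys \<subseteq> f ` B"
  obtains xs where "map f xs = ys" "set xs \<subseteq> B"
proof -
  have "ys \<in> map f ` lists B"
    using assms by (auto simp flip: lists_image)
  then show ?thesis using that by auto
qed

context
  fixes G :: "'a monoid"
  assumes G: "group G"
begin

interpretation G: group G by (rule G)

interpretation T: sym_brace "trivial_brace G"
  by (rule trivial_brace_sym_brace[OF G])

lemma dot_trivial_brace: "dot (trivial_brace G) = G"
  by (simp add: trivial_brace_def)

lemma upper_central_normal: "upper_central G n \<lhd> G"
  using T.ideal_normal[OF T.annihilator_series_ideal]
  by (simp add: upper_central_eq_annihilator_series[OF G] dot_trivial_brace)

lemma upper_central_Suc_iff:
  "z \<in> upper_central G (Suc n) \<longleftrightarrow>
    z \<in> carrier G \<and> (\<forall>x \<in> carrier G. commutator G x z \<in> upper_central G n)"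
proof -
  interpret N: normal "upper_central G n" G by (rule upper_central_normal)
  have "commutator G x z \<in> upper_central G n \<longleftrightarrow> commutator G z x \<in> upper_central G n"
    if "x \<in> carrier G" "z \<in> carrier G" for x
    using that by (metis G.inv_commutator N.m_inv_closed)
  then show ?thesis
    using T.annihilator_series_Suc_iff[of z n] N.one_closed
    by (auto simp: dot_trivial_brace trivial_brace_star[OF G]
        simp del: upper_central.simps simp flip: upper_central_eq_annihilator_series[OF G])
qed

text \<open>Unwinding the recursion: membership in the \<open>n\<close>-th center is tested by right-normed
  commutators, which is how an isoclinism sees it.\<close>

lemma upper_central_iff:
  "z \<in> upper_central G n \<longleftrightarrow> z \<in> carrier G \<and>
    (\<forall>xs. length xs = n \<longrightarrow> set xs \<subseteq> carrier G \<longrightarrow> iterated_commutator G (xs @ [z]) = \<one>\<^bsub>G\<^esub>)"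
proof (induction n arbitrary: z)
  case 0
  then show ?case by auto
next
  case (Suc n)
  have "(\<forall>x \<in> carrier G. commutator G x z \<in> upper_central G n) \<longleftrightarrow>
      (\<forall>ys. length ys = Suc n \<longrightarrow> set ys \<subseteq> carrier G \<longrightarrow> iterated_commutator G (ys @ [z]) = \<one>\<^bsub>G\<^esub>)"
    if z: "z \<in> carrier G"
  proof -
    have "(\<forall>ys. length ys = Suc n \<longrightarrow> P ys) \<longleftrightarrow> (\<forall>xs x. length xs = n \<longrightarrow> P (xs @ [x]))"
      for P :: "'a list \<Rightarrow> bool"
      by (metis length_append_singleton length_Suc_conv_rev)
    then show ?thesis
      using z by (auto simp: Suc G.iterated_commutator_snoc)
  qed
  then show ?case
    unfolding upper_central_Suc_iff by blast
qed

text \<open>The form used below: the test entries range over the projection of a set of pairs.\<close>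

lemma upper_central_iff_image:
  assumes f: "f ` B = carrier G"
  shows "z \<in> upper_central G n \<longleftrightarrow> z \<in> carrier G \<and>
    (\<forall>ps. length ps = n \<longrightarrow> set ps \<subseteq> B \<longrightarrow> iterated_commutator G (map f ps @ [z]) = \<one>\<^bsub>G\<^esub>)"
    (is "?L \<longleftrightarrow> ?R")
proof
  assume z: ?L
  show ?R
  proof (intro conjI allI impI)
    show "z \<in> carrier G" using z upper_central_iff by blast
    fix ps assume "length ps = n" "set ps \<subseteq> B"
    moreover from this have "set (map f ps) \<subseteq> carrier G" using f by auto
    ultimately show "iterated_commutator G (map f ps @ [z]) = \<one>\<^bsub>G\<^esub>"
      using z upper_central_iff[of z n] by simp
  qed
next
  assume r: ?R
  show ?L
    unfolding upper_central_iff
  proof (intro conjI allI impI)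
    fix xs assume xs: "length xs = n" "set xs \<subseteq> carrier G"
    then obtain ps where "map f ps = xs" "set ps \<subseteq> B"
      using map_preimage_list[of xs f B] f by auto
    with r xs show "iterated_commutator G (xs @ [z]) = \<one>\<^bsub>G\<^esub>" by auto
  qed (use r in blast)
qed

lemma iterated_commutator_cong:
  assumes "length gs = Suc n" "set gs \<subseteq> carrier G" "set hs \<subseteq> carrier G"
    and "list_all2 (\<lambda>g h. upper_central G n #>\<^bsub>G\<^esub> g = upper_central G n #>\<^bsub>G\<^esub> h) gs hs"
  shows "iterated_commutator G gs = iterated_commutator G hs"
proof -
  let ?m = "replicate n Gamma"
  have hs: "length hs = Suc n" using assms(1,4) list_all2_lengthD by fastforce
  have "annihilator_series (trivial_brace G) 0 #>\<^bsub>G\<^esub> word_value (trivial_brace G) ?m gs =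
      annihilator_series (trivial_brace G) 0 #>\<^bsub>G\<^esub> word_value (trivial_brace G) ?m hs"
    using T.word_value_cong[of gs ?m hs 0] assms
    by (simp add: dot_trivial_brace flip: upper_central_eq_annihilator_series[OF G])
  then have "{\<one>\<^bsub>G\<^esub>} #>\<^bsub>G\<^esub> iterated_commutator G gs = {\<one>\<^bsub>G\<^esub>} #>\<^bsub>G\<^esub> iterated_commutator G hs"
    using T.word_value_Gamma[OF assms(1)] T.word_value_Gamma[OF hs] by (simp add: dot_trivial_brace)
  then show ?thesis
    using assms(2,3) by (simp add: r_coset_def G.iterated_commutator_closed)
qed

end

text \<open>The relation \<open>R\<close> is a subgroup of \<open>G \<times> H\<close> projecting onto both factors, and \<open>\<theta>\<close> is an isomorphism
between subgroups that may be larger than the lower central terms. If \<open>\<theta>\<close> matches the iterated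
commutators of \<open>R\<close>-related entries, then triviality of such commutators is the same on both sides.
Hence \<open>R\<close> relates the \<open>n\<close>-th centers to each other and induces the isomorphism \<open>\<alpha>\<close>, and \<open>\<theta>\<close>
restricts to the subgroups that the commutators generate.\<close>

lemma group_isoclinicI:
  fixes G :: "'a monoid" and H :: "'b monoid"
  assumes G: "group G" and H: "group H"
    and R: "subgroup R (G \<times>\<times> H)" and fst_R: "fst ` R = carrier G" and snd_R: "snd ` R = carrier H"
    and S: "subgroup S G" and T: "subgroup T H"
    and \<theta>: "\<theta> \<in> iso (G\<lparr>carrier := S\<rparr>) (H\<lparr>carrier := T\<rparr>)"
    and comm: "\<And>ps. length ps = Suc n \<Longrightarrow> set ps \<subseteq> R \<Longrightarrow>
      iterated_commutator G (map fst ps) \<in> S \<and>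
      \<theta> (iterated_commutator G (map fst ps)) = iterated_commutator H (map snd ps)"
  shows "group_isoclinic n G H"
proof -
  interpret G: group G by fact
  interpret H: group H by fact
  let ?Z = "upper_central G n" and ?Y = "upper_central H n"
  interpret Z: normal ?Z G by (rule upper_central_normal[OF G])
  interpret Y: normal ?Y H by (rule upper_central_normal[OF H])
  interpret \<theta>: group_hom "G\<lparr>carrier := S\<rparr>" "H\<lparr>carrier := T\<rparr>" \<theta>
    using \<theta> G.subgroup_imp_group[OF S] H.subgroup_imp_group[OF T]
    by (simp add: group_hom_def group_hom_axioms_def iso_def)
  have \<theta>_inj: "inj_on \<theta> S"
    using \<theta> by (simp add: iso_def bij_betw_def)
  have Rc: "g \<in> carrier G" "h \<in> carrier H" if "(g, h) \<in> R" for g h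
    using subgroup.subset[OF R] that by (auto simp: DirProd_def)
  have R_mult: "(g \<otimes>\<^bsub>G\<^esub> g', h \<otimes>\<^bsub>H\<^esub> h') \<in> R" if "(g, h) \<in> R" "(g', h') \<in> R" for g h g' h'
    using subgroup.m_closed[OF R that] by simp
  have R_inv: "(inv\<^bsub>G\<^esub> g, inv\<^bsub>H\<^esub> h) \<in> R" if "(g, h) \<in> R" for g h
    using subgroup.m_inv_closed[OF R that] Rc[OF that] G H by simp
  have \<theta>_one: "\<theta> x = \<one>\<^bsub>H\<^esub> \<longleftrightarrow> x = \<one>\<^bsub>G\<^esub>" if "x \<in> S" for x
    using inj_on_eq_iff[OF \<theta>_inj that subgroup.one_closed[OF S]] \<theta>.hom_one by simp
  have central: "g \<in> ?Z \<longleftrightarrow> h \<in> ?Y" if gh: "(g, h) \<in> R" for g h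
  proof -
    have eq: "iterated_commutator G (map fst ps @ [g]) = \<one>\<^bsub>G\<^esub> \<longleftrightarrow>
        iterated_commutator H (map snd ps @ [h]) = \<one>\<^bsub>H\<^esub>"
      if "length ps = n" "set ps \<subseteq> R" for ps
    proof -
      have "iterated_commutator G (map fst ps @ [g]) \<in> S"
        "\<theta> (iterated_commutator G (map fst ps @ [g])) = iterated_commutator H (map snd ps @ [h])"
        using comm[of "ps @ [(g, h)]"] that gh by simp_all
      then show ?thesis using \<theta>_one by metis
    qed
    then show ?thesis
      unfolding upper_central_iff_image[OF G fst_R] upper_central_iff_image[OF H snd_R]
      using Rc[OF gh] by auto
  qed
  have coset: "?Z #>\<^bsub>G\<^esub> g = ?Z #>\<^bsub>G\<^esub> g' \<longleftrightarrow> ?Y #>\<^bsub>H\<^esub> h = ?Y #>\<^bsub>H\<^esub> h'"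
    if "(g, h) \<in> R" "(g', h') \<in> R" for g h g' h'
    using central[OF R_mult[OF that(1) R_inv[OF that(2)]]] Rc[OF that(1)] Rc[OF that(2)]
    by (simp add: G.coset_eq_iff[OF Z.subgroup_axioms] H.coset_eq_iff[OF Y.subgroup_axioms])
  define \<alpha> where "\<alpha> K = (THE W. \<exists>(g, h) \<in> R. K = ?Z #>\<^bsub>G\<^esub> g \<and> W = ?Y #>\<^bsub>H\<^esub> h)" for K
  have \<alpha>: "\<alpha> (?Z #>\<^bsub>G\<^esub> g) = ?Y #>\<^bsub>H\<^esub> h" if "(g, h) \<in> R" for g h
    unfolding \<alpha>_def using that coset by (intro the_equality) fast+
  have coset_left: "\<exists>g h. (g, h) \<in> R \<and> K = ?Z #>\<^bsub>G\<^esub> g" if "K \<in> carrier (G Mod ?Z)" for K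
    using that unfolding carrier_FactGroup fst_R[symmetric] by force
  have coset_right: "\<exists>g h. (g, h) \<in> R \<and> K = ?Y #>\<^bsub>H\<^esub> h" if "K \<in> carrier (H Mod ?Y)" for K
    using that unfolding carrier_FactGroup snd_R[symmetric] by force
  have "\<alpha> \<in> iso (G Mod ?Z) (H Mod ?Y)"
  proof (rule isoI)
    show "\<alpha> \<in> hom (G Mod ?Z) (H Mod ?Y)"
    proof (rule homI)
      fix K assume "K \<in> carrier (G Mod ?Z)"
      then obtain g h where gh: "(g, h) \<in> R" "K = ?Z #>\<^bsub>G\<^esub> g"
        using coset_left by blast
      then show "\<alpha> K \<in> carrier (H Mod ?Y)"
        using \<alpha> Rc by (auto simp: carrier_FactGroup)
      fix K' assume "K' \<in> carrier (G Mod ?Z)"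
      then obtain g' h' where gh': "(g', h') \<in> R" "K' = ?Z #>\<^bsub>G\<^esub> g'"
        using coset_left by blast
      have "\<alpha> (?Z #>\<^bsub>G\<^esub> (g \<otimes>\<^bsub>G\<^esub> g')) = ?Y #>\<^bsub>H\<^esub> (h \<otimes>\<^bsub>H\<^esub> h')"
        by (rule \<alpha>[OF R_mult[OF gh(1) gh'(1)]])
      then show "\<alpha> (K \<otimes>\<^bsub>G Mod ?Z\<^esub> K') = \<alpha> K \<otimes>\<^bsub>H Mod ?Y\<^esub> \<alpha> K'"
        using gh gh' \<alpha> Rc[OF gh(1)] Rc[OF gh'(1)] by (simp add: Z.rcos_sum Y.rcos_sum)
    qed
    have "inj_on \<alpha> (carrier (G Mod ?Z))"
    proof (rule inj_onI)
      fix K K' assume K: "K \<in> carrier (G Mod ?Z)" and K': "K' \<in> carrier (G Mod ?Z)"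
        and eq: "\<alpha> K = \<alpha> K'"
      obtain g h where gh: "(g, h) \<in> R" "K = ?Z #>\<^bsub>G\<^esub> g"
        using coset_left[OF K] by blast
      obtain g' h' where gh': "(g', h') \<in> R" "K' = ?Z #>\<^bsub>G\<^esub> g'"
        using coset_left[OF K'] by blast
      show "K = K'"
        using eq gh gh' \<alpha>[OF gh(1)] \<alpha>[OF gh'(1)] coset[OF gh(1) gh'(1)] by simp
    qed
    moreover have "carrier (H Mod ?Y) \<subseteq> \<alpha> ` carrier (G Mod ?Z)"
    proof
      fix W assume "W \<in> carrier (H Mod ?Y)"
      then obtain g h where gh: "(g, h) \<in> R" "W = ?Y #>\<^bsub>H\<^esub> h"
        using coset_right by blast
      then show "W \<in> \<alpha> ` carrier (G Mod ?Z)"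
        using \<alpha>[OF gh(1)] Rc[OF gh(1)] by (auto simp: carrier_FactGroup)
    qed
    ultimately show "bij_betw \<alpha> (carrier (G Mod ?Z)) (carrier (H Mod ?Y))"
      using \<open>\<alpha> \<in> hom _ _\<close> by (auto simp: bij_betw_def hom_def Pi_def)
  qed
  moreover have "\<theta> \<in> iso (G\<lparr>carrier := lower_central G (n + 1)\<rparr>) (H\<lparr>carrier := lower_central H (n + 1)\<rparr>)"
  proof -
    define C where "C = {iterated_commutator G gs | gs. length gs = Suc n \<and> set gs \<subseteq> carrier G}"
    define D where "D = {iterated_commutator H hs | hs. length hs = Suc n \<and> set hs \<subseteq> carrier H}"
    have lift_G: "\<exists>ps. map fst ps = gs \<and> set ps \<subseteq> R" if "set gs \<subseteq> carrier G" for gs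
      using that fst_R map_preimage_list by metis
    have lift_H: "\<exists>ps. map snd ps = hs \<and> set ps \<subseteq> R" if "set hs \<subseteq> carrier H" for hs
      using that snd_R map_preimage_list by metis
    have C: "C = (\<lambda>ps. iterated_commutator G (map fst ps)) ` {ps. length ps = Suc n \<and> set ps \<subseteq> R}"
      unfolding C_def
    proof (intro equalityI subsetI)
      fix c assume "c \<in> {iterated_commutator G gs | gs. length gs = Suc n \<and> set gs \<subseteq> carrier G}"
      then obtain gs where gs: "c = iterated_commutator G gs" "length gs = Suc n" "set gs \<subseteq> carrier G"
        by blast
      obtain ps where "map fst ps = gs" "set ps \<subseteq> R" using lift_G[OF gs(3)] by blast
      with gs show "c \<in> (\<lambda>ps. iterated_commutator G (map fst ps)) ` {ps. length ps = Suc n \<and> set ps \<subseteq> R}"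
        by auto
    qed (use fst_R in \<open>force intro: exI[of _ "map fst ps" for ps]\<close>)
    have D: "D = (\<lambda>ps. iterated_commutator H (map snd ps)) ` {ps. length ps = Suc n \<and> set ps \<subseteq> R}"
      unfolding D_def
    proof (intro equalityI subsetI)
      fix c assume "c \<in> {iterated_commutator H hs | hs. length hs = Suc n \<and> set hs \<subseteq> carrier H}"
      then obtain hs where hs: "c = iterated_commutator H hs" "length hs = Suc n" "set hs \<subseteq> carrier H"
        by blast
      obtain ps where "map snd ps = hs" "set ps \<subseteq> R" using lift_H[OF hs(3)] by blast
      with hs show "c \<in> (\<lambda>ps. iterated_commutator H (map snd ps)) ` {ps. length ps = Suc n \<and> set ps \<subseteq> R}"
        by auto
    qed (use snd_R in \<open>force intro: exI[of _ "map snd ps" for ps]\<close>)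
    have CS: "C \<subseteq> S" and \<theta>C: "\<theta> ` C = D"
      unfolding C D using comm by (auto simp: image_iff)
    have DT: "D \<subseteq> T" using \<theta>C CS \<theta>.hom_closed by auto
    have gen: "lower_central G (n + 1) = generate G C" "lower_central H (n + 1) = generate H D"
      using G.lower_central_eq_generate H.lower_central_eq_generate by (simp_all add: C_def D_def)
    have "\<theta> ` generate G C = generate H D"
      using \<theta>.generate_img[of C] CS DT \<theta>C G.generate_consistent[OF CS S] H.generate_consistent[OF DT T]
      by simp
    moreover have sub: "generate G C \<subseteq> S"
      by (rule G.generate_subgroup_incl[OF CS S])
    moreover have "\<theta> (x \<otimes>\<^bsub>G\<^esub> y) = \<theta> x \<otimes>\<^bsub>H\<^esub> \<theta> y" if "x \<in> S" "y \<in> S" for x y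
      using \<theta>.hom_mult that by simp
    ultimately show ?thesis
      unfolding gen iso_def hom_def bij_betw_def
      using inj_on_subset[OF \<theta>_inj sub] by (auto simp: subset_iff)
  qed
  \<comment> \<open>The entries \<open>hs\<close> need not be \<open>R\<close>-related to \<open>gs\<close>, only congruent to related ones modulo the
    \<open>n\<close>-th center, which does not change the iterated commutator.\<close>
  moreover have "\<theta> (iterated_commutator G gs) = iterated_commutator H hs"
    if len: "length gs = n + 1" "length hs = n + 1" and gs: "set gs \<subseteq> carrier G"
      and hs: "set hs \<subseteq> carrier H"
      and eq: "\<forall>i < n + 1. \<alpha> (?Z #>\<^bsub>G\<^esub> gs ! i) = ?Y #>\<^bsub>H\<^esub> hs ! i" for gs hs
  proof -
    obtain ps where ps: "map fst ps = gs" "set ps \<subseteq> R"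
      using map_preimage_list[of gs fst R] gs fst_R by metis
    have len_ps: "length ps = Suc n" using ps(1) len(1) by auto
    have "?Y #>\<^bsub>H\<^esub> snd (ps ! i) = ?Y #>\<^bsub>H\<^esub> hs ! i" if "i < Suc n" for i
    proof -
      have "(fst (ps ! i), snd (ps ! i)) \<in> R" using that len_ps ps(2) nth_mem by fastforce
      from \<alpha>[OF this] show ?thesis using eq that ps(1) len_ps by auto
    qed
    then have "list_all2 (\<lambda>g h. ?Y #>\<^bsub>H\<^esub> g = ?Y #>\<^bsub>H\<^esub> h) (map snd ps) hs"
      using len_ps len by (simp add: list_all2_conv_all_nth)
    moreover have "set (map snd ps) \<subseteq> carrier H" using ps(2) snd_R by auto
    ultimately have "iterated_commutator H (map snd ps) = iterated_commutator H hs"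
      using iterated_commutator_cong[OF H _ _ hs] len_ps by simp
    then show ?thesis using comm[OF len_ps ps(2)] ps(1) by simp
  qed
  ultimately show ?thesis
    unfolding group_isoclinic_def by blast
qed

section \<open>The fibre product of isoclinic braces\<close>

definition brace_prod :: "'a brace \<Rightarrow> 'b brace \<Rightarrow> ('a \<times> 'b) brace" where
  "brace_prod A B = \<lparr>dot = dot A \<times>\<times> dot B, circ = circ A \<times>\<times> circ B\<rparr>"

lemma skew_brace_prod:
  assumes A: "skew_brace A" and B: "skew_brace B"
  shows "skew_brace (brace_prod A B)"
  using A B
  by (auto simp: skew_brace_def brace_prod_def DirProd_group)

lemma skew_brace_sub:
  assumes A: "skew_brace A" and S: "subgroup S (dot A)" "subgroup S (circ A)"
  shows "skew_brace (sub_brace A S)"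
proof -
  have groups: "group (dot A)" "group (circ A)" using A by (auto simp: skew_brace_def)
  show ?thesis
    using A S groups subgroup.mem_carrier[OF S(1)]
    by (auto simp: skew_brace_def sub_brace_def group.subgroup_imp_group group.m_inv_consistent)
qed

lemma sym_brace_sub_prod:
  assumes "sym_brace A" "sym_brace B"
    and R: "subgroup R (dot A \<times>\<times> dot B)" "subgroup R (circ A \<times>\<times> circ B)"
  shows "sym_brace (sub_brace (brace_prod A B) R)"
proof -
  have A: "skew_brace A" "skew_brace \<lparr>dot = circ A, circ = dot A\<rparr>"
    and B: "skew_brace B" "skew_brace \<lparr>dot = circ B, circ = dot B\<rparr>"
    using assms by (auto simp: sym_brace_def symmetric_skew_brace_def)
  have "skew_brace (sub_brace (brace_prod A B) R)"
    using R by (intro skew_brace_sub skew_brace_prod A B) (simp_all add: brace_prod_def)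
  moreover have "skew_brace (sub_brace (brace_prod \<lparr>dot = circ A, circ = dot A\<rparr>
      \<lparr>dot = circ B, circ = dot B\<rparr>) R)"
    using R by (intro skew_brace_sub skew_brace_prod A B) (simp_all add: brace_prod_def)
  ultimately show ?thesis
    by (simp add: sym_brace_def symmetric_skew_brace_def sub_brace_def brace_prod_def)
qed

lemma fibre_product_subgroup:
  assumes "group_hom G K f" "group_hom H K g"
  shows "subgroup {p \<in> carrier G \<times> carrier H. f (fst p) = g (snd p)} (G \<times>\<times> H)"
proof -
  interpret f: group_hom G K f by fact
  interpret g: group_hom H K g by fact
  interpret P: group "G \<times>\<times> H" by (rule DirProd_group[OF f.G.is_group g.G.is_group])
  show ?thesis
    by (rule P.subgroupI)
      (auto simp: f.G.is_group g.G.is_group intro!: exI[of _ "\<one>\<^bsub>G\<^esub>"] exI[of _ "\<one>\<^bsub>H\<^esub>"])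
qed

text \<open>A long word is a short word with an inner value as its last argument.\<close>

lemma word_value_append:
  "length as = length m1 + length m2 + 1 \<Longrightarrow> word_value A (m1 @ m2) as =
    word_value A m1 (take (length m1) as @ [word_value A m2 (drop (length m1) as)])"
proof (induction m1 arbitrary: as)
  case (Cons e m1)
  then obtain b bs where "as = b # bs" by (cases as) auto
  then show ?case using Cons by simp
qed simp

theorem corollary6p17:
  fixes n :: nat and A :: "'a brace" and B :: "'b brace"
  assumes "n \<ge> 1"
    and "symmetric_skew_brace A" and "symmetric_skew_brace B"
    and "brace_isoclinic n A B"
  shows "group_isoclinic n (dot A) (dot B) \<and> group_isoclinic n (circ A) (circ B)"
proof -
  interpret A: sym_brace A by unfold_locales (rule assms)
  interpret B: sym_brace B by unfold_locales (rule assms)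
  let ?I = "annihilator_series A n" and ?J = "annihilator_series B n"
  let ?p = "\<lambda>a. ?I #>\<^bsub>dot A\<^esub> a" and ?q = "\<lambda>b. ?J #>\<^bsub>dot B\<^esub> b"
  let ?V = "word_subgroup A n" and ?W = "word_subgroup B n"
  note I = A.annihilator_series_ideal[of n] and J = B.annihilator_series_ideal[of n]
  obtain \<xi> \<theta> where \<xi>: "\<xi> \<in> brace_iso (brace_quot A ?I) (brace_quot B ?J)"
    and \<theta>: "\<theta> \<in> brace_iso (sub_brace A ?V) (sub_brace B ?W)"
    and compat: "\<And>m Xs. length m = n \<Longrightarrow> length Xs = n + 1 \<Longrightarrow>
      set Xs \<subseteq> carrier (dot (brace_quot A ?I)) \<Longrightarrow> \<theta> (word_map A m Xs) = word_map B m (map \<xi> Xs)"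
    using assms(4) unfolding brace_isoclinic_def by blast
  interpret p: sym_brace_hom A "brace_quot A ?I" ?p by (rule A.quot_sym_brace_hom[OF I])
  interpret q: sym_brace_hom B "brace_quot B ?J" ?q by (rule B.quot_sym_brace_hom[OF J])
  define R where "R = {r \<in> carrier (dot A) \<times> carrier (dot B). \<xi> (?p (fst r)) = ?q (snd r)}"
  have \<xi>_hom: "\<xi> \<in> hom (dot (brace_quot A ?I)) (dot (brace_quot B ?J))"
    "\<xi> \<in> hom (circ (brace_quot A ?I)) (circ (brace_quot B ?J))"
    and \<xi>_surj: "\<xi> ` carrier (dot (brace_quot A ?I)) = carrier (dot (brace_quot B ?J))"
    using \<xi> by (auto simp: brace_iso_def iso_def bij_betw_def)
  have R_dot: "subgroup R (dot A \<times>\<times> dot B)"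
  proof -
    have "group_hom (dot A) (dot (brace_quot B ?J)) (\<lambda>a. \<xi> (?p a))"
      using hom_compose[OF p.dot.homh \<xi>_hom(1)]
      by (simp add: group_hom_def group_hom_axioms_def o_def)
    then show ?thesis
      unfolding R_def by (rule fibre_product_subgroup) (rule q.dot.group_hom_axioms)
  qed
  have R_circ: "subgroup R (circ A \<times>\<times> circ B)"
  proof -
    have "group_hom (circ A) (circ (brace_quot B ?J)) (\<lambda>a. \<xi> (?p a))"
      using hom_compose[OF p.circ.homh \<xi>_hom(2)]
      by (simp add: group_hom_def group_hom_axioms_def o_def)
    from fibre_product_subgroup[OF this q.circ.group_hom_axioms] show ?thesis
      by (simp add: R_def)
  qed
  let ?P = "sub_brace (brace_prod A B) R"
  interpret P: sym_brace ?P
    by (rule sym_brace_sub_prod[OF A.sym_brace_axioms B.sym_brace_axioms R_dot R_circ])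
  have car_P [simp]: "carrier (dot ?P) = R" by (simp add: sub_brace_def)
  have Rc: "fst r \<in> carrier (dot A)" "snd r \<in> carrier (dot B)" if "r \<in> R" for r
    using that by (auto simp: R_def)
  interpret fst: sym_brace_hom ?P A fst
    by unfold_locales (auto simp: brace_hom_def hom_def sub_brace_def brace_prod_def Rc)
  interpret snd: sym_brace_hom ?P B snd
    by unfold_locales (auto simp: brace_hom_def hom_def sub_brace_def brace_prod_def Rc)
  have cosets: "\<xi> ` ?p ` carrier (dot A) = ?q ` carrier (dot B)"
    using \<xi>_surj by (simp only: A.carrier_quot[OF I] B.carrier_quot[OF J])
  have fst_R: "fst ` R = carrier (dot A)"
  proof (intro equalityI subsetI)
    fix a assume a: "a \<in> carrier (dot A)"
    then have "\<xi> (?p a) \<in> ?q ` carrier (dot B)"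
      unfolding cosets[symmetric] by (intro imageI)
    then obtain b where "b \<in> carrier (dot B)" "\<xi> (?p a) = ?q b" by blast
    then have "(a, b) \<in> R" using a by (simp add: R_def)
    then show "a \<in> fst ` R" by force
  qed (auto simp: R_def)
  have snd_R: "snd ` R = carrier (dot B)"
  proof (intro equalityI subsetI)
    fix b assume b: "b \<in> carrier (dot B)"
    then have "?q b \<in> \<xi> ` ?p ` carrier (dot A)"
      unfolding cosets by (intro imageI)
    then obtain a where "a \<in> carrier (dot A)" "\<xi> (?p a) = ?q b"
      by (elim imageE) simp
    then have "(a, b) \<in> R" using b by (simp add: R_def)
    then show "b \<in> snd ` R" by force
  qed (auto simp: R_def)
  have \<theta>_dot: "\<theta> \<in> iso (dot A\<lparr>carrier := ?V\<rparr>) (dot B\<lparr>carrier := ?W\<rparr>)"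
    and \<theta>_circ: "\<theta> \<in> iso (circ A\<lparr>carrier := ?V\<rparr>) (circ B\<lparr>carrier := ?W\<rparr>)"
    using \<theta> by (auto simp: brace_iso_def sub_brace_def)
  interpret \<theta>: group_hom "dot A\<lparr>carrier := ?V\<rparr>" "dot B\<lparr>carrier := ?W\<rparr>" \<theta>
    using \<theta>_dot A.L.subgroup_imp_group[OF A.word_subgroup_subgroup]
      B.L.subgroup_imp_group[OF B.word_subgroup_subgroup]
    by (simp add: group_hom_def group_hom_axioms_def iso_def)
  \<comment> \<open>The hypothesis on \<open>\<theta>\<close>, read in the fibre product.\<close>
  have words: "fst (word_value ?P m rs) \<in> ?V \<and> \<theta> (fst (word_value ?P m rs)) = snd (word_value ?P m rs)"
    if m: "length m = n" and rs: "length rs = length m + 1" "set rs \<subseteq> R" for m rs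
  proof -
    let ?as = "map fst rs" and ?bs = "map snd rs"
    have as: "length ?as = length m + 1" "set ?as \<subseteq> carrier (dot A)"
      and bs: "length ?bs = length m + 1" "set ?bs \<subseteq> carrier (dot B)"
      using rs by (auto simp: R_def)
    have Xs: "set (map ?p ?as) \<subseteq> carrier (dot (brace_quot A ?I))"
      using as(2) p.dot.hom_closed by auto
    have \<xi>_map: "map \<xi> (map ?p ?as) = map ?q ?bs"
      using rs(2) by (auto simp: R_def)
    have "\<theta> (word_value A m ?as) = \<theta> (word_map A m (map ?p ?as))"
      using A.word_map_eq[OF as] by (simp only: m)
    also have "\<dots> = word_map B m (map ?q ?bs)"
      using compat[OF m _ Xs] as(1) m by (simp only: \<xi>_map length_map)
    also have "\<dots> = word_value B m ?bs"
      using B.word_map_eq[OF bs] by (simp only: m)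
    finally have "\<theta> (word_value A m ?as) = word_value B m ?bs" .
    moreover have "word_value A m ?as \<in> ?V"
      unfolding word_subgroup_def using as m by (intro generate.incl) blast
    ultimately show ?thesis
      using fst.hom_word_value[of rs m] snd.hom_word_value[of rs m] rs by simp
  qed
  have graph: "fst r \<in> ?V \<and> \<theta> (fst r) = snd r" if r: "r \<in> word_subgroup ?P n" for r
  proof -
    have long: "fst w \<in> ?V \<and> \<theta> (fst w) = snd w" if w: "w \<in> P.word_values n" for w
    proof -
      obtain m rs where w: "w = word_value ?P m rs" and m: "n \<le> length m"
        and rs: "length rs = length m + 1" "set rs \<subseteq> R"
        using w by auto
      let ?m1 = "take n m" and ?m2 = "drop n m"
      let ?r = "word_value ?P ?m2 (drop n rs)"
      have "?r \<in> R"
        using P.word_value_closed[of "drop n rs" ?m2] m rs set_drop_subset[of n rs] by auto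
      moreover have "w = word_value ?P ?m1 (take n rs @ [?r])"
        using word_value_append[of rs ?m1 ?m2 ?P] m rs by (simp add: w min_absorb2)
      ultimately show ?thesis
        using words[of ?m1 "take n rs @ [?r]"] m rs set_take_subset[of n rs] by auto
    qed
    have mem: "s \<in> R" if "s \<in> word_subgroup ?P n" for s
      using P.word_subgroup_carrier that by auto
    have word_R: "w \<in> R" if "w \<in> P.word_values n" for w
      using P.word_values_carrier that by auto
    show ?thesis using r unfolding word_subgroup_def[of ?P]
    proof (induction r rule: generate.induct)
      case one
      show ?case
        using fst.dot.hom_one snd.dot.hom_one \<theta>.hom_one
          subgroup.one_closed[OF A.word_subgroup_subgroup[of n]] by simp
    next
      case (incl w)
      then show ?case by (rule long)
    next
      case (inv w)
      then show ?case
        using long[OF inv] word_R[OF inv] \<theta>.hom_inv[of "fst w"] \<theta>.hom_closed[of "fst w"]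
          subgroup.m_inv_closed[OF A.word_subgroup_subgroup[of n], of "fst w"]
        by (simp add: A.L.m_inv_consistent[OF A.word_subgroup_subgroup]
            B.L.m_inv_consistent[OF B.word_subgroup_subgroup])
    next
      case (eng r s)
      then have "r \<in> R" "s \<in> R" using mem by (auto simp: word_subgroup_def)
      then show ?case
        using eng.IH \<theta>.hom_mult[of "fst r" "fst s"]
          subgroup.m_closed[OF A.word_subgroup_subgroup[of n], of "fst r" "fst s"]
        by simp
    qed
  qed
  have "group_isoclinic n (dot A) (dot B)"
  proof (rule group_isoclinicI[OF A.L.is_group B.L.is_group R_dot fst_R snd_R
        A.word_subgroup_subgroup B.word_subgroup_subgroup \<theta>_dot])
    fix ps assume ps: "length ps = Suc n" "set ps \<subseteq> R"
    then show "iterated_commutator (dot A) (map fst ps) \<in> ?V \<and>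
        \<theta> (iterated_commutator (dot A) (map fst ps)) = iterated_commutator (dot B) (map snd ps)"
      using graph[OF P.dot_iterated_commutator_word_subgroup[OF ps(1)]]
        fst.dot.hom_iterated_commutator[of ps] snd.dot.hom_iterated_commutator[of ps] by simp
  qed
  moreover have "group_isoclinic n (circ A) (circ B)"
  proof (rule group_isoclinicI[OF A.C.is_group B.C.is_group R_circ _ _
        A.word_subgroup_circ_subgroup B.word_subgroup_circ_subgroup \<theta>_circ])
    fix ps assume ps: "length ps = Suc n" "set ps \<subseteq> R"
    then show "iterated_commutator (circ A) (map fst ps) \<in> ?V \<and>
        \<theta> (iterated_commutator (circ A) (map fst ps)) = iterated_commutator (circ B) (map snd ps)"
      using graph[OF P.circ_iterated_commutator_word_subgroup[OF ps(1)]]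
        fst.circ.hom_iterated_commutator[of ps] snd.circ.hom_iterated_commutator[of ps] by simp
  qed (use fst_R snd_R in simp_all)
  ultimately show ?thesis by blast
qed

end
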